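(* Let $X$ be a coverable uniform space. Then: (1) If $\widetilde{X}$ is simply connected then $\lambda:\pi_1(X)\to\delta_1(X)$ is injective. (2) If $X$ is pathwise connected and $\lambda:\pi_1(X)\to\delta_1(X)$ is injective then $\widetilde{X}$ is simply connected.
   Context: A topological space is called simply connected if every loop in it is null-homotopic, regardless of whether it is pathwise connected. All entourages are taken to be symmetric. Fix a basepoint $*\in X$. For an entourage $E$ of a uniform space $X$, an $E$-chain from $p$ to $q$ is a finite sequence $\{x_0=p,\dots,x_n=q\}$ with $(x_i,x_{i+1})\in E$ for all $i$; it is an $E$-loop if $p=q$. Two $E$-chains with the same endpoints are $E$-homotopic if one is obtained from the other in finitely many steps, each adding or removing a single point, always keeping the endpoints fixed and keeping an $E$-chain at each stage (in particular $\{p\}$ and $\{p,p\}$ are $E$-homotopic); $[\alpha]_E$ is the class of $\alpha$. $X_E$ is the set of $E$-homotopy classes of $E$-chains starting at $*$. For an entourage $D\subset E$ let $D^*$ be the set of pairs $([*=x_0,\dots,x_n,y]_E,[*=x_0,\dots,x_n,z]_E)$ with $(y,z)\in D$; $X_E$ carries the uniformity with base $\{D^*:D\subset E\}$. For $F\subset E$, $\phi_{EF}:X_F\to X_E$ is $[\alpha]_F\mapsto[\alpha]_E$. $\widetilde{X}=\varprojlim X_E$ (over all entourages, ordered by reverse inclusion, with the inverse limit uniformity and basepoint $*=([*]_E)_E$), with projections $\phi_E:\widetilde{X}\to X_E$ and $\phi:\widetilde{X}\to X=X_{X\times X}$. $X$ is coverable if its uniformity has a base, containing $X\times X$, of entourages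 $E$ for which $\phi_E$ is surjective. $\delta_E(X)$ is the group of $E$-homotopy classes of $E$-loops at $*$ under concatenation, acting on $X_E$ by $[\lambda]_E\cdot[\alpha]_E=[\lambda*\alpha]_E$. $\delta_1(X)=\varprojlim\delta_E(X)$ (bonding maps $[\lambda]_F\mapsto[\lambda]_E$) acts coordinatewise on $\widetilde{X}$; as a subset of $\widetilde{X}$ it equals $\phi^{-1}( * )$. Every path $c:[0,1]\to X$ with $c(0)=*$ has a unique continuous lift $c_L:[0,1]\to\widetilde{X}$ with $c_L(0)=*$ and $\phi\circ c_L=c$. The natural homomorphism $\lambda:\pi_1(X)=\pi_1(X,* )\to\delta_1(X)$ is $\lambda([c])=c_L(1)\in\phi^{-1}( * )=\delta_1(X)$, which is well defined. *)

theory Defs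
  imports "HOL-Analysis.Analysis"
begin

section \<open>Uniform structures on carrier sets\<close>

text \<open>
  The type class of uniform spaces covers \<open>X\<close>, but not the spaces constructed from it below, whose
  carriers depend on a basepoint. For those, a uniformity on a set \<open>S\<close> is a filter below
  \<open>principal (S \<times> S)\<close>, and its topology is obtained by the formula of the class axiom \<open>open_uniformity\<close>.
\<close>

definition uniform_topology :: "'a set \<Rightarrow> ('a \<times> 'a) filter \<Rightarrow> 'a topology" where
  "uniform_topology S \<U> =
     topology (\<lambda>U. U \<subseteq> S \<and> (\<forall>x\<in>U. eventually (\<lambda>(x', y). x' = x \<longrightarrow> y \<in> U) \<U>))"

lemma openin_uniform_topology:
  "openin (uniform_topology S \<U>) U \<longleftrightarrow>
     U \<subseteq> S \<and> (\<forall>x\<in>U. eventually (\<lambda>(x', y). x' = x \<longrightarrow> y \<in> U) \<U>)"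
proof -
  let ?P = "\<lambda>U. U \<subseteq> S \<and> (\<forall>x\<in>U. eventually (\<lambda>(x', y). x' = x \<longrightarrow> y \<in> U) \<U>)"
  have "istopology ?P"
    unfolding istopology_def
  proof (intro conjI allI impI ballI)
    fix U V assume U: "?P U" and V: "?P V"
    then show "U \<inter> V \<subseteq> S" by auto
    fix x assume "x \<in> U \<inter> V"
    then have "eventually (\<lambda>p. (case p of (x', y) \<Rightarrow> x' = x \<longrightarrow> y \<in> U) \<and>
                               (case p of (x', y) \<Rightarrow> x' = x \<longrightarrow> y \<in> V)) \<U>"
      using U V by (auto intro!: eventually_conj)
    then show "eventually (\<lambda>(x', y). x' = x \<longrightarrow> y \<in> U \<inter> V) \<U>"
      by (rule eventually_mono) auto
  next
    fix K assume K: "\<forall>U\<in>K. ?P U"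
    then show "\<Union>K \<subseteq> S" by auto
    fix x assume "x \<in> \<Union>K"
    then obtain U where "U \<in> K" "x \<in> U" by auto
    with K have "eventually (\<lambda>(x', y). x' = x \<longrightarrow> y \<in> U) \<U>" by auto
    then show "eventually (\<lambda>(x', y). x' = x \<longrightarrow> y \<in> \<Union>K) \<U>"
      by (rule eventually_mono) (use \<open>U \<in> K\<close> in auto)
  qed
  then show ?thesis
    by (simp add: uniform_topology_def topology_inverse')
qed

lemma topspace_uniform_topology:
  assumes "\<U> \<le> principal (S \<times> S)"
  shows "topspace (uniform_topology S \<U>) = S"
proof -
  have "eventually (\<lambda>(x', y). x' = x \<longrightarrow> y \<in> S) \<U>" for x
    using assms by (auto simp: le_principal elim: eventually_mono)
  then have "openin (uniform_topology S \<U>) S"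
    unfolding openin_uniform_topology by simp
  then show ?thesis
    using openin_subset[of "uniform_topology S \<U>" S] openin_topspace[of "uniform_topology S \<U>"]
    unfolding openin_uniform_topology by blast
qed


section \<open>Simply connected spaces, fundamental group\<close>

text \<open>
  Path-connectedness is deliberately not required, in contrast to \<open>simply_connected\<close> of the
  library.
\<close>

definition simply_connected_space :: "'a topology \<Rightarrow> bool" where
  "simply_connected_space T \<longleftrightarrow>
     (\<forall>g. pathin T g \<and> g 0 = g 1 \<longrightarrow>
        homotopic_with (\<lambda>h. h 0 = g 0 \<and> h 1 = g 0) (top_of_set {0..1}) T g (\<lambda>_. g 0))"

definition loop_class :: "(real \<Rightarrow> 'a::topological_space) \<Rightarrow> (real \<Rightarrow> 'a) set" where
  "loop_class c = {d. homotopic_paths UNIV c d}"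

text \<open>The underlying set of \<open>\<pi>\<^sub>1(X, a)\<close>.\<close>

definition pi1 :: "'a::topological_space \<Rightarrow> (real \<Rightarrow> 'a) set set" where
  "pi1 a = {loop_class c | c. path c \<and> pathstart c = a \<and> pathfinish c = a}"


section \<open>Chains and their homotopies\<close>

definition entourage :: "('a::uniform_space \<times> 'a) set \<Rightarrow> bool" where
  "entourage E \<longleftrightarrow> eventually (\<lambda>p. p \<in> E) uniformity \<and> sym E"

text \<open>The chain \<open>{x\<^sub>0, \<dots>, x\<^sub>n}\<close> is the nonempty list of its \<open>n + 1\<close> points.\<close>

definition chain :: "('a \<times> 'a) set \<Rightarrow> 'a list \<Rightarrow> bool" where
  "chain E xs \<longleftrightarrow> xs \<noteq> [] \<and> successively (\<lambda>x y. (x, y) \<in> E) xs"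

definition add_point :: "('a \<times> 'a) set \<Rightarrow> 'a list \<Rightarrow> 'a list \<Rightarrow> bool" where
  "add_point E xs ys \<longleftrightarrow> chain E xs \<and> chain E ys \<and> hd xs = hd ys \<and> last xs = last ys \<and>
     (\<exists>us vs x. xs = us @ vs \<and> ys = us @ x # vs)"

abbreviation chain_homotopic :: "('a \<times> 'a) set \<Rightarrow> 'a list \<Rightarrow> 'a list \<Rightarrow> bool" where
  "chain_homotopic E \<equiv> equivclp (add_point E)"

definition chain_class :: "('a \<times> 'a) set \<Rightarrow> 'a list \<Rightarrow> 'a list set" where
  "chain_class E xs = {ys. chain_homotopic E xs ys}"

lemma chain_homotopic_ends:
  assumes "chain_homotopic E xs ys"
  shows "hd ys = hd xs" "last ys = last xs" "chain E ys \<longleftrightarrow> chain E xs"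
  using assms by (induction rule: equivclp_induct) (auto simp: add_point_def)

lemma chain_class_eq_iff: "chain_class E xs = chain_class E ys \<longleftrightarrow> chain_homotopic E xs ys"
proof
  assume "chain_class E xs = chain_class E ys"
  then show "chain_homotopic E xs ys"
    by (simp add: chain_class_def set_eq_iff)
next
  assume "chain_homotopic E xs ys"
  then show "chain_class E xs = chain_class E ys"
    unfolding chain_class_def by (blast intro: equivclp_trans equivclp_sym)
qed

lemma chain_class_refl [simp]: "xs \<in> chain_class E xs"
  by (simp add: chain_class_def)


section \<open>The spaces \<open>X\<^sub>E\<close> and their inverse limit\<close>

definition chain_space :: "'a \<Rightarrow> ('a \<times> 'a) set \<Rightarrow> 'a list set set" where
  "chain_space a E = {chain_class E xs | xs. chain E xs \<and> hd xs = a}"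

definition star_entourage ::
    "'a \<Rightarrow> ('a \<times> 'a) set \<Rightarrow> ('a \<times> 'a) set \<Rightarrow> ('a list set \<times> 'a list set) set" where
  "star_entourage a E D =
     {(chain_class E (xs @ [y]), chain_class E (xs @ [z])) | xs y z.
        xs \<noteq> [] \<and> hd xs = a \<and> chain E (xs @ [y]) \<and> chain E (xs @ [z]) \<and> (y, z) \<in> D}"

definition chain_uniformity ::
    "'a::uniform_space \<Rightarrow> ('a \<times> 'a) set \<Rightarrow> ('a list set \<times> 'a list set) filter" where
  "chain_uniformity a E = (INF D\<in>{D. entourage D \<and> D \<subseteq> E}. principal (star_entourage a E D))"

text \<open>
  The bonding map \<open>\<phi>\<^sub>E\<^sub>F\<close>, for \<open>F \<subseteq> E\<close>. It depends on \<open>F\<close> only through its domain.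
\<close>

definition bond :: "('a \<times> 'a) set \<Rightarrow> 'a list set \<Rightarrow> 'a list set" where
  "bond E C = the_elem (chain_class E ` C)"

lemma bond_chain_class:
  assumes "F \<subseteq> E"
  shows "bond E (chain_class F xs) = chain_class E xs"
proof -
  have mono: "chain_homotopic E xs ys" if "chain_homotopic F xs ys" for ys
  proof -
    have chain_mono: "chain F zs \<Longrightarrow> chain E zs" for zs
      using assms unfolding chain_def by (auto elim: successively_mono)
    have "add_point F us vs \<Longrightarrow> add_point E us vs" for us vs
      using chain_mono unfolding add_point_def by blast
    then have "add_point F us vs \<or> add_point F vs us \<Longrightarrow> add_point E us vs \<or> add_point E vs us" for us vs
      by blast
    with that show ?thesis
      by (induction rule: equivclp_induct) (blast intro: equivclp_refl equivclp_into_equivclp)+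
  qed
  have "chain_class E ys = chain_class E xs" if "ys \<in> chain_class F xs" for ys
    using mono[of ys] that chain_class_eq_iff[of E xs ys] by (simp add: chain_class_def[of F])
  then have "chain_class E ` chain_class F xs = {chain_class E xs}"
    using chain_class_refl[of xs F] by blast
  then show ?thesis
    by (simp add: bond_def)
qed

text \<open>Elements of the limit are extensional families indexed by the entourages.\<close>

definition cover :: "'a::uniform_space \<Rightarrow> (('a \<times> 'a) set \<Rightarrow> 'a list set) set" where
  "cover a = {u \<in> Pi\<^sub>E {E. entourage E} (chain_space a).
     \<forall>E F. entourage E \<and> entourage F \<and> F \<subseteq> E \<longrightarrow> bond E (u F) = u E}"

definition cover_base :: "'a::uniform_space \<Rightarrow> ('a \<times> 'a) set \<Rightarrow> 'a list set" where
  "cover_base a = (\<lambda>E\<in>{E. entourage E}. chain_class E [a])"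

definition cover_uniformity ::
    "'a::uniform_space \<Rightarrow> ((('a \<times> 'a) set \<Rightarrow> 'a list set) \<times> (('a \<times> 'a) set \<Rightarrow> 'a list set)) filter" where
  "cover_uniformity a =
     inf (INF E\<in>{E. entourage E}. filtercomap (\<lambda>(u, v). (u E, v E)) (chain_uniformity a E))
         (principal (cover a \<times> cover a))"

definition cover_topology :: "'a::uniform_space \<Rightarrow> (('a \<times> 'a) set \<Rightarrow> 'a list set) topology" where
  "cover_topology a = uniform_topology (cover a) (cover_uniformity a)"

lemma topspace_cover_topology [simp]: "topspace (cover_topology a) = cover a"
  unfolding cover_topology_def cover_uniformity_def by (simp add: topspace_uniform_topology)

text \<open>
  The projection \<open>\<phi>\<close>, where \<open>X\<close> is identified with the chain space of the entourage \<open>UNIV\<close> by sending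
  a class of chains to their common endpoint.
\<close>

definition cover_proj :: "(('a \<times> 'a) set \<Rightarrow> 'a list set) \<Rightarrow> 'a" where
  "cover_proj u = the_elem (last ` u UNIV)"

definition coverable :: "'a::uniform_space \<Rightarrow> bool" where
  "coverable a \<longleftrightarrow>
     (\<exists>\<B>. UNIV \<in> \<B> \<and> (\<forall>E\<in>\<B>. entourage E) \<and> (\<forall>F. entourage F \<longrightarrow> (\<exists>E\<in>\<B>. E \<subseteq> F)) \<and>
          (\<forall>E\<in>\<B>. (\<lambda>u. u E) ` cover a = chain_space a E))"


section \<open>The group \<open>\<delta>\<^sub>1\<close> and the natural map\<close>

definition delta :: "'a \<Rightarrow> ('a \<times> 'a) set \<Rightarrow> 'a list set set" where
  "delta a E = {chain_class E xs | xs. chain E xs \<and> hd xs = a \<and> last xs = a}"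

text \<open>The underlying set of \<open>\<delta>\<^sub>1(X)\<close>.\<close>

definition delta1 :: "'a::uniform_space \<Rightarrow> (('a \<times> 'a) set \<Rightarrow> 'a list set) set" where
  "delta1 a = {u \<in> Pi\<^sub>E {E. entourage E} (delta a).
     \<forall>E F. entourage E \<and> entourage F \<and> F \<subseteq> E \<longrightarrow> bond E (u F) = u E}"

lemma last_chain_class: "last ` chain_class E xs = {last xs}"
proof -
  have "last ys = last xs" if "ys \<in> chain_class E xs" for ys
    using that chain_homotopic_ends(2)[of E xs ys] by (simp add: chain_class_def)
  then show ?thesis
    using chain_class_refl[of xs E] by blast
qed

lemma entourage_UNIV: "entourage UNIV"
  by (simp add: entourage_def sym_def)

lemma delta1_eq_fibre: "delta1 a = {u \<in> cover a. cover_proj u = a}"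
proof (intro equalityI subsetI)
  fix u assume u: "u \<in> delta1 a"
  then have "u UNIV \<in> delta a UNIV"
    by (auto simp: delta1_def entourage_UNIV)
  then have "cover_proj u = a"
    by (auto simp: delta_def cover_proj_def last_chain_class)
  moreover have "delta a E \<subseteq> chain_space a E" for E
    by (auto simp: delta_def chain_space_def)
  ultimately show "u \<in> {u \<in> cover a. cover_proj u = a}"
    using u unfolding delta1_def cover_def PiE_iff by blast
next
  fix u assume u: "u \<in> {u \<in> cover a. cover_proj u = a}"
  have "u E \<in> delta a E" if E: "entourage E" for E
  proof -
    obtain xs where xs: "u E = chain_class E xs" "chain E xs" "hd xs = a"
      using u E by (auto simp: cover_def chain_space_def PiE_iff)
    have "bond UNIV (u E) = u UNIV"
      using u E by (auto simp: cover_def entourage_UNIV)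
    then have "u UNIV = chain_class UNIV xs"
      by (simp add: xs bond_chain_class)
    then have "last xs = a"
      using u by (simp add: cover_proj_def last_chain_class)
    with xs show ?thesis
      by (auto simp: delta_def)
  qed
  with u show "u \<in> delta1 a"
    by (auto simp: delta1_def cover_def PiE_iff)
qed

text \<open>
  Paths are total functions on the reals; extensionality makes the lift to the unit interval unique.
\<close>

definition path_lift ::
    "'a::uniform_space \<Rightarrow> (real \<Rightarrow> 'a) \<Rightarrow> real \<Rightarrow> ('a \<times> 'a) set \<Rightarrow> 'a list set" where
  "path_lift a c = (THE l. l \<in> extensional {0..1} \<and> pathin (cover_topology a) l \<and>
     l 0 = cover_base a \<and> (\<forall>t\<in>{0..1}. cover_proj (l t) = c t))"

definition natural_map ::
    "'a::uniform_space \<Rightarrow> (real \<Rightarrow> 'a) set \<Rightarrow> ('a \<times> 'a) set \<Rightarrow> 'a list set" where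
  "natural_map a C = the_elem ((\<lambda>c. path_lift a c 1) ` C)"

end

theory Submission
  imports Defs
begin

text \<open>
  The projection \<open>\<phi>\<close> from the inverse limit to \<open>X\<close> behaves like a covering map: continuous maps
  from compact convex sets lift along it (\<open>lift_exists\<close>), and a lift over a connected set is
  determined by one of its values (\<open>lift_unique\<close>). Both are proved at each level \<open>X\<^sub>E\<close> separately.
  There the mechanism is that a class \<open>[x\<^sub>0, \<dots>, x\<^sub>n]\<^sub>E\<close> has exactly one neighbour
  \<open>[x\<^sub>0, \<dots>, x\<^sub>n, z]\<^sub>E\<close> over each point \<open>z\<close> that is \<open>E\<close>-close to \<open>x\<^sub>n\<close>, so \<open>X\<^sub>E \<rightarrow> X\<close> is
  bijective on uniformly large pieces. A map into the limit is continuous exactly when, at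
  each level, its values at nearby points are such one-point extensions of one another
  (\<open>continuous_map_cover_iff\<close>).

  Suppose that the limit is simply connected and that the lifts of two loops \<open>c\<close> and \<open>d\<close> at the
  basepoint end at the same point. Then the lift of \<open>c\<close> followed by the reverse of \<open>d\<close> is a loop.
  It is null-homotopic, and its null-homotopy projects to one in \<open>X\<close>, so \<open>c\<close> and \<open>d\<close> are
  homotopic.

  Conversely, let \<open>g\<close> be a loop in the limit, lying over the loop \<open>h\<close> in \<open>X\<close>, and choose a path \<open>p\<close>
  from the basepoint to the start of \<open>h\<close>. The loop \<open>g\<close> may lie in a different path component from
  the lift of \<open>p\<close> that starts at the basepoint. However, whether a lift of \<open>h\<close> closes up does not
  depend on its starting point in the fibre, because \<open>\<delta>\<^sub>E(X)\<close> acts transitively on the fibres of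
  \<open>X\<^sub>E \<rightarrow> X\<close> and sends lifts to lifts (\<open>lift_holonomy\<close>). So the lift of \<open>p\<close> followed by \<open>h\<close> and
  the reverse of \<open>p\<close> is closed. Injectivity makes this loop null-homotopic, hence also \<open>h\<close>, and
  lifting the homotopy from the starting point of \<open>g\<close> contracts \<open>g\<close> (\<open>lift_path_homotopy\<close>).
\<close>


section \<open>Chains\<close>

lemma entourage_refl: "entourage E \<Longrightarrow> refl E"
  unfolding entourage_def refl_on_def using uniformity_refl[of "\<lambda>p. p \<in> E"] by blast

lemma entourage_sym: "entourage E \<Longrightarrow> sym E"
  by (simp add: entourage_def)

lemma entourage_Int: "entourage D \<Longrightarrow> entourage E \<Longrightarrow> entourage (D \<inter> E)"
  unfolding entourage_def by (auto intro: eventually_conj sym_Int)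

lemma entourage_half:
  assumes "entourage E"
  obtains D where "entourage D" "D O D \<subseteq> E"
proof -
  obtain P where P: "eventually P uniformity" "\<And>x y z. P (x, y) \<Longrightarrow> P (y, z) \<Longrightarrow> (x, z) \<in> E"
    using assms uniformity_transE[of "\<lambda>p. p \<in> E"] unfolding entourage_def by metis
  let ?D = "{p. P p \<and> (case p of (x, y) \<Rightarrow> P (y, x))}"
  have "entourage ?D"
    unfolding entourage_def using P(1) uniformity_sym[OF P(1)]
    by (auto intro: eventually_conj simp: sym_def)
  moreover have "?D O ?D \<subseteq> E"
    using P(2) by auto
  ultimately show thesis ..
qed

lemma chain_replace:
  assumes "chain E (us @ xs @ vs)" "xs \<noteq> []" "chain E ys" "hd ys = hd xs" "last ys = last xs"
  shows "chain E (us @ ys @ vs)"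
  using assms by (auto simp: chain_def successively_append_iff)

text \<open>
  A homotopy of a chain can be carried out inside any longer chain: the moves fix the endpoints,
  so the two joints with the rest of the chain remain valid.
\<close>

lemma chain_homotopic_context:
  assumes "chain_homotopic E xs ys" "chain E xs" "chain E (us @ xs @ vs)"
  shows "chain_homotopic E (us @ xs @ vs) (us @ ys @ vs)"
  using assms
proof (induction rule: equivclp_induct)
  case base
  show ?case by (rule equivclp_refl)
next
  case (step y z)
  have chains: "chain E (us @ w @ vs)" if "chain_homotopic E xs w" for w
    using chain_homotopic_ends[OF that] step.prems chain_replace[of E us xs vs w]
    by (simp add: chain_def)
  have "add_point E (us @ v @ vs) (us @ w @ vs)"
    if vw: "add_point E v w" "chain_homotopic E xs v" "chain_homotopic E xs w" for v w
  proof -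
    have ends: "hd v = hd w" "last v = last w" "v \<noteq> []" "w \<noteq> []"
      using vw(1) by (simp_all add: add_point_def chain_def)
    obtain vs' ws' x where "v = vs' @ ws'" "w = vs' @ x # ws'"
      using vw(1) unfolding add_point_def by blast
    then have "us @ v @ vs = (us @ vs') @ (ws' @ vs)" "us @ w @ vs = (us @ vs') @ x # (ws' @ vs)"
      by simp_all
    moreover have "hd (us @ v @ vs) = hd (us @ w @ vs)" "last (us @ v @ vs) = last (us @ w @ vs)"
      using ends by (auto simp: hd_append last_append)
    ultimately show ?thesis
      using chains[OF vw(2)] chains[OF vw(3)] unfolding add_point_def by blast
  qed
  moreover have "chain_homotopic E xs z"
    using step.hyps by (blast intro: equivclp_into_equivclp)
  ultimately have "add_point E (us @ y @ vs) (us @ z @ vs) \<or> add_point E (us @ z @ vs) (us @ y @ vs)"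
    using step.hyps by blast
  with step.IH[OF step.prems] show ?case
    by (blast intro: equivclp_into_equivclp)
qed

lemma chain_class_context:
  assumes "chain_class E xs = chain_class E ys" "chain E xs" "chain E (us @ xs @ vs)"
  shows "chain_class E (us @ xs @ vs) = chain_class E (us @ ys @ vs)"
  using assms chain_homotopic_context by (simp add: chain_class_eq_iff)

lemma chain_class_insert:
  assumes "chain E (us @ vs)" "chain E (us @ x # vs)" "us \<noteq> []" "vs \<noteq> []"
  shows "chain_class E (us @ x # vs) = chain_class E (us @ vs)"
proof -
  have "add_point E (us @ vs) (us @ x # vs)"
    unfolding add_point_def using assms by auto
  then show ?thesis
    unfolding chain_class_eq_iff by (blast intro: r_into_equivclp equivclp_sym)
qed

lemma chain_snoc:
  "xs \<noteq> [] \<Longrightarrow> chain E (xs @ [x]) \<longleftrightarrow> chain E xs \<and> (last xs, x) \<in> E"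
  by (auto simp: chain_def successively_append_iff)

text \<open>
  Repeating the last point counts as adding a point: the new point is inserted just before the
  last one, to which it is equal, so the last position is not touched.
\<close>

lemma chain_class_snoc_last:
  assumes "refl E" "chain E xs"
  shows "chain_class E (xs @ [last xs]) = chain_class E xs"
proof -
  have ne: "xs \<noteq> []" using assms by (simp add: chain_def)
  have c: "chain E (xs @ [last xs])"
    using assms ne by (simp add: chain_snoc refl_on_def)
  have eq: "butlast xs @ [last xs, last xs] = xs @ [last xs]" "butlast xs @ [last xs] = xs"
    using ne by (metis append_Cons append_Nil append_assoc append_butlast_last_id)+
  have "hd (xs @ [last xs]) = hd xs" using ne by simp
  then have "add_point E xs (xs @ [last xs])"
    unfolding add_point_def using c assms(2) eq
    by (intro conjI exI[of _ "butlast xs"] exI[of _ "[last xs]"] exI[of _ "last xs"]) auto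
  then show ?thesis
    unfolding chain_class_eq_iff by (blast intro: r_into_equivclp equivclp_sym)
qed

lemma chain_class_snoc_snoc:
  assumes "chain E xs" "(last xs, y) \<in> E" "(y, z) \<in> E" "(last xs, z) \<in> E"
  shows "chain_class E (xs @ [y, z]) = chain_class E (xs @ [z])"
proof -
  have "xs \<noteq> []" using assms(1) by (simp add: chain_def)
  then show ?thesis
    using chain_class_insert[of E xs "[z]" y] assms by (simp add: chain_def successively_append_iff)
qed

text \<open>
  Going back along a chain and forth again cancels from the turning point outwards: at the turning
  point one value occurs twice, and after both copies are removed the next value occurs twice.
\<close>

lemma chain_class_backtrack:
  assumes "refl E" "sym E" "chain E us" "chain E xs" "last us = last xs"
  shows "chain_class E (us @ rev xs @ xs) = chain_class E us"
  using assms(4,5)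
proof (induction xs)
  case Nil
  then show ?case by (simp add: chain_def)
next
  case (Cons y ys)
  have E: "(z, z) \<in> E" for z using \<open>refl E\<close> by (simp add: refl_on_def)
  have us: "us \<noteq> []" "chain E us" using assms(3) by (simp_all add: chain_def)
  have revE: "successively (\<lambda>u v. (v, u) \<in> E) zs = successively (\<lambda>u v. (u, v) \<in> E) zs" for zs
    using \<open>sym E\<close> by (metis (no_types, lifting) successively_mono symD)
  show ?case
  proof (cases "ys = []")
    case True
    with Cons.prems have "last us = y" by simp
    have "chain_class E (us @ [y, y]) = chain_class E (us @ [y])"
      by (rule chain_class_snoc_snoc) (use us E \<open>last us = y\<close> in simp_all)
    also have "\<dots> = chain_class E us"
      using chain_class_snoc_last[OF assms(1,3)] \<open>last us = y\<close> by simp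
    finally show ?thesis using True by simp
  next
    case False
    have ys: "successively (\<lambda>u v. (u, v) \<in> E) ys" "(y, hd ys) \<in> E" "(hd ys, y) \<in> E"
      using Cons.prems False \<open>sym E\<close> by (auto simp: chain_def successively_Cons dest: symD)
    have c: "chain E (us @ rev ys @ ys)" "chain E (us @ rev ys @ y # ys)"
      "chain E (us @ rev ys @ y # y # ys)"
      using us ys False E Cons.prems
      by (auto simp: chain_def successively_append_iff successively_Cons revE last_rev hd_rev)
    have "chain_class E (us @ rev (y # ys) @ y # ys) = chain_class E ((us @ rev ys @ [y]) @ y # ys)"
      by simp
    also have "\<dots> = chain_class E ((us @ rev ys @ [y]) @ ys)"
      by (rule chain_class_insert) (use c False in simp_all)
    also have "\<dots> = chain_class E ((us @ rev ys) @ y # ys)"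
      by simp
    also have "\<dots> = chain_class E ((us @ rev ys) @ ys)"
      by (rule chain_class_insert) (use c us False in simp_all)
    also have "\<dots> = chain_class E us"
      using Cons False ys by (simp add: chain_def)
    finally show ?thesis .
  qed
qed

text \<open>
  Two chains that run side by side are homotopic after the second one replaces the end of the
  first. The induction moves the crossing from rung \<open>j\<close> to rung \<open>j + 1\<close> by inserting \<open>P (j + 1)\<close>
  after \<open>Q j\<close>, which needs the diagonals, and then removing \<open>Q j\<close>. This is what makes the lifts
  constructed below depend continuously on their argument.
\<close>

lemma chain_class_ladder:
  assumes "refl E" "chain E xs" "P 0 = last xs" "Q 0 = last xs"
    and rungs: "\<And>j. j \<le> n \<Longrightarrow> (P j, Q j) \<in> E"
    and P: "\<And>j. j < n \<Longrightarrow> (P j, P (Suc j)) \<in> E"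
    and Q: "\<And>j. j < n \<Longrightarrow> (Q j, Q (Suc j)) \<in> E"
    and diagonals: "\<And>j. j < n \<Longrightarrow> (Q j, P (Suc j)) \<in> E"
  shows "chain E (xs @ map P [1..<Suc n]) \<and> chain E (xs @ map Q [1..<Suc n]) \<and>
    last (xs @ map P [1..<Suc n]) = P n \<and> last (xs @ map Q [1..<Suc n]) = Q n \<and>
    chain_class E (xs @ map Q [1..<Suc n]) = chain_class E (xs @ map P [1..<Suc n] @ [Q n])"
  using rungs P Q diagonals
proof (induction n)
  case 0
  then show ?case
    using assms chain_class_snoc_last[OF assms(1,2)] by simp
next
  case (Suc n)
  define p where "p = xs @ map P [1..<Suc n]"
  define q where "q = xs @ map Q [1..<Suc n]"
  have IH: "chain E p" "chain E q" "last p = P n" "last q = Q n"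
    "chain_class E q = chain_class E (p @ [Q n])"
    using Suc by (simp_all add: p_def q_def del: upt_Suc)
  have E: "(P n, Q n) \<in> E" "(P n, P (Suc n)) \<in> E" "(Q n, Q (Suc n)) \<in> E"
    "(Q n, P (Suc n)) \<in> E" "(P (Suc n), Q (Suc n)) \<in> E"
    using Suc.prems by simp_all
  have ne: "p \<noteq> []" "q \<noteq> []" using IH by (simp_all add: chain_def)
  have snoc: "xs @ map P [1..<Suc (Suc n)] = p @ [P (Suc n)]"
    "xs @ map Q [1..<Suc (Suc n)] = q @ [Q (Suc n)]"
    "xs @ map P [1..<Suc (Suc n)] @ [Q (Suc n)] = (p @ [P (Suc n)]) @ [Q (Suc n)]"
    by (simp_all add: p_def q_def)
  have c: "chain E (p @ [P (Suc n)])" "chain E (q @ [Q (Suc n)])" "chain E (p @ [Q n])"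
    using IH E ne by (simp_all add: chain_snoc)
  have "chain_class E (q @ [Q (Suc n)]) = chain_class E ((p @ [Q n]) @ [Q (Suc n)])"
    using chain_class_context[OF IH(5) IH(2), of "[]" "[Q (Suc n)]"] c by simp
  also have "\<dots> = chain_class E ((p @ [Q n]) @ [P (Suc n), Q (Suc n)])"
    by (rule chain_class_snoc_snoc[symmetric]) (use c E in simp_all)
  also have "\<dots> = chain_class E (p @ Q n # [P (Suc n), Q (Suc n)])"
    by simp
  also have "\<dots> = chain_class E (p @ [P (Suc n), Q (Suc n)])"
    by (rule chain_class_insert)
      (use IH E ne in \<open>simp_all add: chain_def successively_append_iff\<close>)
  finally show ?case
    using c unfolding snoc by simp
qed


section \<open>One-point extensions of classes of chains\<close>

definition endpoint :: "'a list set \<Rightarrow> 'a" where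
  "endpoint C = the_elem (last ` C)"

lemma endpoint_chain_class [simp]: "endpoint (chain_class E xs) = last xs"
  by (simp add: endpoint_def last_chain_class)

text \<open>
  Closeness in \<open>X\<^sub>E\<close> refers to a chain with a free last point. This says that the chain may be
  any representative \<open>xs\<close> of the class, kept whole: if two chains differ only in their
  last points \<open>y\<close> and \<open>z\<close>, then inserting \<open>y\<close> before \<open>z\<close> exhibits the second as an extension of
  the first.
\<close>

lemma star_entourage_iff:
  assumes "refl E" "D \<subseteq> E" "chain E xs" "hd xs = a"
  shows "(chain_class E xs, C) \<in> star_entourage a E D \<longleftrightarrow>
    (\<exists>z. (last xs, z) \<in> D \<and> C = chain_class E (xs @ [z]))"
proof
  assume "(chain_class E xs, C) \<in> star_entourage a E D"
  then obtain ws y z where ws: "chain_class E xs = chain_class E (ws @ [y])"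
    "C = chain_class E (ws @ [z])" "ws \<noteq> []" "chain E (ws @ [y])" "chain E (ws @ [z])" "(y, z) \<in> D"
    unfolding star_entourage_def by blast
  have y: "last xs = y" using arg_cong[OF ws(1), of endpoint] by simp
  have ne: "xs \<noteq> []" using assms(3) by (simp add: chain_def)
  have "chain_class E (xs @ [z]) = chain_class E (ws @ [y, z])"
    using chain_class_context[OF ws(1) assms(3), of "[]" "[z]"] y ws assms ne by (auto simp: chain_snoc)
  also have "\<dots> = C"
    unfolding ws(2) by (rule chain_class_snoc_snoc) (use ws assms(2) in \<open>auto simp: chain_snoc\<close>)
  finally show "\<exists>z. (last xs, z) \<in> D \<and> C = chain_class E (xs @ [z])"
    using ws y by auto
next
  assume "\<exists>z. (last xs, z) \<in> D \<and> C = chain_class E (xs @ [z])"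
  then obtain z where z: "(last xs, z) \<in> D" "C = chain_class E (xs @ [z])" by blast
  have ne: "xs \<noteq> []" using assms(3) by (simp add: chain_def)
  have "chain_class E xs = chain_class E (xs @ [last xs])"
    using chain_class_snoc_last assms by metis
  moreover have "chain E (xs @ [last xs])" "chain E (xs @ [z])"
    using assms z ne by (auto simp: chain_snoc refl_on_def)
  ultimately show "(chain_class E xs, C) \<in> star_entourage a E D"
    unfolding star_entourage_def using z assms(4) ne by blast
qed

lemma chain_spaceE:
  assumes "C \<in> chain_space a E"
  obtains xs where "C = chain_class E xs" "chain E xs" "hd xs = a"
  using assms by (auto simp: chain_space_def)

lemma star_entourage_chain_space:
  assumes "(C, C') \<in> star_entourage a E D"
  shows "C \<in> chain_space a E" "C' \<in> chain_space a E"
  using assms unfolding star_entourage_def chain_space_def by fastforce+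

lemma star_entourage_refl:
  assumes "refl E" "C \<in> chain_space a E"
  shows "(C, C) \<in> star_entourage a E E"
  using assms star_entourage_iff[of E E _ a C] chain_class_snoc_last
  by (metis (no_types, lifting) chain_spaceE refl_onD UNIV_I subset_refl)

lemma star_entourage_sym:
  assumes "sym E" "(C, C') \<in> star_entourage a E E"
  shows "(C', C) \<in> star_entourage a E E"
  using assms unfolding star_entourage_def by (blast dest: symD)

lemma star_entourage_trans:
  assumes "refl E" "D \<subseteq> E" "D O D \<subseteq> E"
    and "(C, C') \<in> star_entourage a E D" "(C', C'') \<in> star_entourage a E D"
  shows "(C, C'') \<in> star_entourage a E E"
proof -
  obtain xs where xs: "C = chain_class E xs" "chain E xs" "hd xs = a"
    using star_entourage_chain_space[OF assms(4)] by (auto elim: chain_spaceE)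
  then have ne: "xs \<noteq> []" by (simp add: chain_def)
  obtain y where y: "(last xs, y) \<in> D" "C' = chain_class E (xs @ [y])"
    using assms(4) star_entourage_iff[OF assms(1,2) xs(2,3)] unfolding xs(1) by blast
  have "chain E (xs @ [y])" using xs y ne assms(2) by (auto simp: chain_snoc)
  then obtain z where z: "(y, z) \<in> D" "C'' = chain_class E (xs @ [y, z])"
    using assms(5) star_entourage_iff[OF assms(1,2), of "xs @ [y]" a C''] xs ne unfolding y(2) by auto
  have "C'' = chain_class E (xs @ [z])"
    unfolding z(2) by (rule chain_class_snoc_snoc) (use xs y z assms(2,3) in auto)
  moreover have "(last xs, z) \<in> E" using y z assms(3) by blast
  ultimately show ?thesis
    unfolding xs(1) star_entourage_iff[OF assms(1) subset_refl xs(2,3)] by blast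
qed

text \<open>
  This is the local injectivity of \<open>X\<^sub>E \<rightarrow> X\<close>, from which the uniqueness of lifts follows.
\<close>

lemma star_entourage_unique:
  assumes "refl E" "(C, C1) \<in> star_entourage a E E" "(C, C2) \<in> star_entourage a E E"
    and "endpoint C1 = endpoint C2"
  shows "C1 = C2"
proof -
  obtain xs where xs: "C = chain_class E xs" "chain E xs" "hd xs = a"
    using star_entourage_chain_space[OF assms(2)] by (auto elim: chain_spaceE)
  show ?thesis
    using assms(2-) star_entourage_iff[OF assms(1) subset_refl xs(2,3)] unfolding xs(1) by auto
qed

lemma star_entourage_endpoint:
  assumes "(C, C') \<in> star_entourage a E D"
  shows "(endpoint C, endpoint C') \<in> D"
  using assms unfolding star_entourage_def by auto

lemma star_entourage_bond:
  assumes "F \<subseteq> E" "(C, C') \<in> star_entourage a F D"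
  shows "(bond E C, bond E C') \<in> star_entourage a E D"
proof -
  have mono: "chain E xs" if "chain F xs" for xs
    using that assms(1) unfolding chain_def by (auto elim: successively_mono)
  show ?thesis
    using assms(2) mono unfolding star_entourage_def
    by (force simp: bond_chain_class[OF assms(1)])
qed

text \<open>
  For an \<open>E\<close>-loop \<open>ws\<close> at the basepoint this is the action of its class in \<open>\<delta>\<^sub>E(X)\<close> on \<open>X\<^sub>E\<close>.
  The representatives both contain the basepoint where they meet; the repetition is harmless.
\<close>

definition prepend :: "('a \<times> 'a) set \<Rightarrow> 'a list \<Rightarrow> 'a list set \<Rightarrow> 'a list set" where
  "prepend E ws C = the_elem ((\<lambda>xs. chain_class E (ws @ xs)) ` C)"

lemma prepend_chain_class:
  assumes "chain E (ws @ xs)" "chain E xs"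
  shows "prepend E ws (chain_class E xs) = chain_class E (ws @ xs)"
proof -
  have "chain_class E (ws @ ys) = chain_class E (ws @ xs)" if "ys \<in> chain_class E xs" for ys
  proof -
    have "chain_class E xs = chain_class E ys"
      using that by (simp add: chain_class_eq_iff) (simp add: chain_class_def)
    then show ?thesis
      using chain_class_context[of E xs ys ws "[]"] assms by simp
  qed
  then have "(\<lambda>ys. chain_class E (ws @ ys)) ` chain_class E xs = {chain_class E (ws @ xs)}"
    using chain_class_refl[of xs E] by blast
  then show ?thesis by (simp add: prepend_def)
qed

lemma star_entourage_prepend:
  assumes "refl E" "chain E ws" "last ws = a" "(C, C') \<in> star_entourage a E E"
  shows "(prepend E ws C, prepend E ws C') \<in> star_entourage (hd ws) E E"
proof -
  obtain xs y z where xs: "C = chain_class E (xs @ [y])" "C' = chain_class E (xs @ [z])" "xs \<noteq> []"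
    "hd xs = a" "chain E (xs @ [y])" "chain E (xs @ [z])" "(y, z) \<in> E"
    using assms(4) unfolding star_entourage_def by blast
  have "(a, a) \<in> E" using assms(1) by (simp add: refl_on_def)
  then have c: "chain E (ws @ xs @ [y])" "chain E (ws @ xs @ [z])"
    using assms xs by (auto simp: chain_def successively_append_iff)
  have ws: "ws \<noteq> []" using assms(2) by (simp add: chain_def)
  show ?thesis
    unfolding star_entourage_def xs(1,2) prepend_chain_class[OF c(1) xs(5)]
      prepend_chain_class[OF c(2) xs(6)]
    using c xs ws by (intro CollectI exI[of _ "ws @ xs"] exI[of _ y] exI[of _ z]) auto
qed

text \<open>
  The loop that carries \<open>[xs]\<close> to \<open>[us]\<close> runs along \<open>us\<close> and returns along \<open>xs\<close>.
\<close>

lemma prepend_transitive: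
  assumes "refl E" "sym E" "C \<in> chain_space a E" "C' \<in> chain_space a E" "endpoint C = endpoint C'"
  obtains ws where "chain E ws" "hd ws = a" "last ws = a" "prepend E ws C = C'"
proof -
  obtain xs where xs: "C = chain_class E xs" "chain E xs" "hd xs = a"
    using assms(3) by (rule chain_spaceE)
  obtain us where us: "C' = chain_class E us" "chain E us" "hd us = a"
    using assms(4) by (rule chain_spaceE)
  have last: "last us = last xs" using assms(5) xs us by simp
  have ne: "xs \<noteq> []" "us \<noteq> []" using xs us by (simp_all add: chain_def)
  have revE: "successively (\<lambda>u v. (v, u) \<in> E) xs"
    using xs(2) \<open>sym E\<close> unfolding chain_def by (metis (no_types, lifting) successively_mono symD)
  have E: "(z, z) \<in> E" for z using \<open>refl E\<close> by (simp add: refl_on_def)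
  have "chain E (us @ rev xs)" "chain E ((us @ rev xs) @ xs)"
    using xs us ne last revE E by (auto simp: chain_def successively_append_iff hd_rev last_rev)
  moreover have "prepend E (us @ rev xs) C = C'"
    unfolding xs(1) prepend_chain_class[OF calculation(2) xs(2)] us(1)
    using chain_class_backtrack[OF assms(1,2) us(2) xs(2) last] by simp
  ultimately show thesis
    using that[of "us @ rev xs"] xs us ne by (simp add: last_rev)
qed


section \<open>The uniformity and the topology of the inverse limit\<close>

lemma cover_chain_space: "u \<in> cover a \<Longrightarrow> entourage E \<Longrightarrow> u E \<in> chain_space a E"
  by (auto simp: cover_def PiE_iff)

lemma cover_bond: "u \<in> cover a \<Longrightarrow> entourage E \<Longrightarrow> entourage F \<Longrightarrow> F \<subseteq> E \<Longrightarrow> bond E (u F) = u E"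
  by (auto simp: cover_def)

lemma cover_eqI:
  assumes "u \<in> cover a" "v \<in> cover a" "\<And>E. entourage E \<Longrightarrow> u E = v E"
  shows "u = v"
  using assms unfolding cover_def by (auto intro: PiE_ext)

lemma endpoint_cover:
  assumes "u \<in> cover a" "entourage E"
  shows "endpoint (u E) = cover_proj u"
proof -
  obtain xs where xs: "u E = chain_class E xs"
    using cover_chain_space[OF assms] by (rule chain_spaceE)
  have "u UNIV = bond UNIV (u E)"
    using cover_bond[OF assms(1) entourage_UNIV assms(2)] by simp
  also have "\<dots> = chain_class UNIV xs"
    unfolding xs by (simp add: bond_chain_class)
  finally show ?thesis
    by (simp add: xs cover_proj_def last_chain_class)
qed

text \<open>
  Because points of the limit are coherent families, closeness at a finer level \<open>F\<close> implies
  closeness at a coarser level \<open>E\<close>. Hence a single entourage suffices to describe a basic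
  neighbourhood, although the uniformity of the limit has a level \<open>E\<close> and an entourage \<open>D\<close>.
\<close>

lemma star_entourage_cover_mono:
  assumes "u \<in> cover a" "v \<in> cover a" "entourage E" "entourage F" "F \<subseteq> E"
    and "(u F, v F) \<in> star_entourage a F D"
  shows "(u E, v E) \<in> star_entourage a E D"
  using star_entourage_bond[OF assms(5,6)] assms by (simp add: cover_bond)

lemma star_entourage_mono: "D \<subseteq> D' \<Longrightarrow> star_entourage a E D \<subseteq> star_entourage a E D'"
  unfolding star_entourage_def by blast

lemma cover_uniformity_eq:
  fixes a :: "'a::uniform_space"
  shows "cover_uniformity a = (INF E\<in>{E. entourage E}.
     principal {(u, v). u \<in> cover a \<and> v \<in> cover a \<and> (u E, v E) \<in> star_entourage a E E})"
  (is "_ = (INF E\<in>_. principal (?R E))")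
proof (rule antisym)
  show "cover_uniformity a \<le> (INF E\<in>{E. entourage E}. principal (?R E))"
  proof (intro INF_greatest)
    fix E :: "('a \<times> 'a) set" assume E: "E \<in> {E. entourage E}"
    have "cover_uniformity a \<le> inf (filtercomap (\<lambda>(u, v). (u E, v E)) (chain_uniformity a E))
        (principal (cover a \<times> cover a))"
      unfolding cover_uniformity_def by (intro inf_mono INF_lower E order_refl)
    also have "\<dots> \<le> inf (filtercomap (\<lambda>(u, v). (u E, v E)) (principal (star_entourage a E E)))
        (principal (cover a \<times> cover a))"
      unfolding chain_uniformity_def
      by (intro inf_mono filtercomap_mono INF_lower2[of E] order_refl) (use E in auto)
    also have "\<dots> \<le> principal (?R E)"
      by (auto simp: filtercomap_principal)
    finally show "cover_uniformity a \<le> principal (?R E)" .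
  qed
  show "(INF E\<in>{E. entourage E}. principal (?R E)) \<le> cover_uniformity a"
    unfolding cover_uniformity_def chain_uniformity_def filtercomap_INF filtercomap_principal
  proof (intro le_infI INF_greatest)
    fix E D :: "('a \<times> 'a) set" assume "E \<in> {E. entourage E}" "D \<in> {D. entourage D \<and> D \<subseteq> E}"
    then show "(INF E\<in>{E. entourage E}. principal (?R E)) \<le>
        principal ((\<lambda>(u, v). (u E, v E)) -` star_entourage a E D)"
      by (intro INF_lower2[of D]) (auto elim!: star_entourage_cover_mono[rotated 5])
  next
    show "(INF E\<in>{E. entourage E}. principal (?R E)) \<le> principal (cover a \<times> cover a)"
      by (rule INF_lower2[of UNIV]) (auto simp: entourage_UNIV)
  qed
qed

lemma eventually_cover_uniformity:
  fixes a :: "'a::uniform_space"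
  shows "eventually P (cover_uniformity a) \<longleftrightarrow>
    (\<exists>E. entourage E \<and>
      (\<forall>u\<in>cover a. \<forall>v\<in>cover a. (u E, v E) \<in> star_entourage a E E \<longrightarrow> P (u, v)))"
proof -
  let ?R = "\<lambda>E. {(u, v). u \<in> cover a \<and> v \<in> cover a \<and> (u E, v E) \<in> star_entourage a E E}"
  have "eventually P (cover_uniformity a) \<longleftrightarrow>
      (\<exists>E\<in>{E. entourage E}. eventually P (principal (?R E)))"
    unfolding cover_uniformity_eq
  proof (rule eventually_INF_base)
    show "{E :: ('a \<times> 'a) set. entourage E} \<noteq> {}" using entourage_UNIV by blast
    fix E F :: "('a \<times> 'a) set" assume EF: "E \<in> {E. entourage E}" "F \<in> {E. entourage E}"
    have "?R (E \<inter> F) \<subseteq> ?R G" if "G = E \<or> G = F" for G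
    proof clarify
      fix u v assume uv: "u \<in> cover a" "v \<in> cover a"
        "(u (E \<inter> F), v (E \<inter> F)) \<in> star_entourage a (E \<inter> F) (E \<inter> F)"
      have "(u G, v G) \<in> star_entourage a G (E \<inter> F)"
        by (rule star_entourage_cover_mono[OF uv(1,2) _ _ _ uv(3)])
          (use EF entourage_Int[of E F] that in auto)
      then show "(u G, v G) \<in> star_entourage a G G"
        using star_entourage_mono[of "E \<inter> F" G] that by blast
    qed
    then have "?R (E \<inter> F) \<subseteq> ?R E \<inter> ?R F"
      by (simp del: Int_Collect)
    then show "\<exists>G\<in>{E. entourage E}. principal (?R G) \<le> inf (principal (?R E)) (principal (?R F))"
      using EF entourage_Int[of E F] by (intro bexI[of _ "E \<inter> F"]) (simp_all add: inf_principal)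
  qed
  then show ?thesis
    by (auto simp: eventually_principal)
qed

text \<open>
  One direction uses only that open sets contain basic neighbourhoods. For the other, the basic
  neighbourhood of \<open>l t\<close> at level \<open>E\<close> need not be open, so the proof passes to the set \<open>V\<close> of the
  points that have a whole neighbourhood inside it; halving an entourage shows that \<open>V\<close> is open.
\<close>

lemma continuous_map_cover_iff:
  fixes a :: "'a::uniform_space" and K :: "'b::topological_space set"
  shows "continuous_map (top_of_set K) (cover_topology a) l \<longleftrightarrow>
    l \<in> K \<rightarrow> cover a \<and>
    (\<forall>E. entourage E \<longrightarrow> (\<forall>t\<in>K. \<forall>\<^sub>F s in at t within K. (l t E, l s E) \<in> star_entourage a E E))"
  (is "?cont \<longleftrightarrow> ?into \<and> ?near")
proof (intro iffI conjI allI impI ballI)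
  assume cont: ?cont
  then show into: ?into by (simp add: continuous_map_def)
  fix E :: "('a \<times> 'a) set" and t assume E: "entourage E" and t: "t \<in> K"
  define V where "V = {v \<in> cover a. \<exists>F. entourage F \<and>
    (\<forall>w\<in>cover a. (v F, w F) \<in> star_entourage a F F \<longrightarrow> (l t E, w E) \<in> star_entourage a E E)}"
  have "openin (cover_topology a) V"
    unfolding cover_topology_def openin_uniform_topology
  proof (intro conjI ballI)
    fix v assume v: "v \<in> V"
    then have v': "v \<in> cover a" by (simp add: V_def)
    obtain F where F: "entourage F"
      "\<And>w. w \<in> cover a \<Longrightarrow> (v F, w F) \<in> star_entourage a F F \<Longrightarrow> (l t E, w E) \<in> star_entourage a E E"
      using v unfolding V_def by blast
    obtain D where D: "entourage D" "D O D \<subseteq> F"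
      using entourage_half[OF F(1)] .
    have DF: "D \<subseteq> F" using D entourage_refl[OF D(1)] by (auto simp: refl_on_def)
    have "w \<in> V" if w: "w \<in> cover a" and vw: "(v D, w D) \<in> star_entourage a D D" for w
    proof -
      have "(l t E, z E) \<in> star_entourage a E E"
        if z: "z \<in> cover a" and wz: "(w D, z D) \<in> star_entourage a D D" for z
      proof (rule F(2)[OF z])
        have "(v F, w F) \<in> star_entourage a F D"
          by (rule star_entourage_cover_mono[where F = D]) (use v' w vw F(1) D(1) DF in auto)
        moreover have "(w F, z F) \<in> star_entourage a F D"
          by (rule star_entourage_cover_mono[where F = D]) (use z w wz F(1) D(1) DF in auto)
        ultimately
        show "(v F, z F) \<in> star_entourage a F F"
          by (rule star_entourage_trans[OF entourage_refl[OF F(1)] DF D(2)])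
      qed
      then show ?thesis unfolding V_def using w D(1) by blast
    qed
    then show "eventually (\<lambda>(x', y). x' = v \<longrightarrow> y \<in> V) (cover_uniformity a)"
      unfolding eventually_cover_uniformity using D(1) by blast
  qed (auto simp: V_def)
  then have "openin (top_of_set K) {s \<in> K. l s \<in> V}"
    using openin_continuous_map_preimage[OF cont] by simp
  then obtain T where T: "open T" "{s \<in> K. l s \<in> V} = K \<inter> T"
    by (auto simp: openin_open)
  have lt: "l t \<in> cover a" using into t by auto
  then have "l t \<in> V" unfolding V_def using E by blast
  then have "t \<in> T" using T(2) t by blast
  moreover have "(l t E, l s E) \<in> star_entourage a E E" if "s \<in> K" "s \<in> T" for s
  proof -
    have "l s \<in> V" using that T(2) by blast
    then obtain F where F: "entourage F" "l s \<in> cover a"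
      "\<And>w. w \<in> cover a \<Longrightarrow> (l s F, w F) \<in> star_entourage a F F \<Longrightarrow> (l t E, w E) \<in> star_entourage a E E"
      unfolding V_def by blast
    then show ?thesis
      using star_entourage_refl[OF entourage_refl[OF F(1)] cover_chain_space[OF F(2,1)]] by blast
  qed
  ultimately show "\<forall>\<^sub>F s in at t within K. (l t E, l s E) \<in> star_entourage a E E"
    unfolding eventually_at_topological using T(1) by blast
next
  assume "?into \<and> ?near"
  then have into: ?into and near: ?near by auto
  show ?cont
    unfolding continuous_map_def
  proof (intro conjI allI impI)
    show "l \<in> topspace (top_of_set K) \<rightarrow> topspace (cover_topology a)"
      using into by simp
    fix U assume U: "openin (cover_topology a) U"
    have "\<exists>T. openin (top_of_set K) T \<and> t \<in> T \<and> T \<subseteq> {s \<in> K. l s \<in> U}"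
      if t: "t \<in> {s \<in> K. l s \<in> U}" for t
    proof -
      have tK: "t \<in> K" and tU: "l t \<in> U" and tc: "l t \<in> cover a" using t into by auto
      have "eventually (\<lambda>(x', y). x' = l t \<longrightarrow> y \<in> U) (cover_uniformity a)"
        using U tU by (simp add: cover_topology_def openin_uniform_topology)
      then obtain E where E: "entourage E"
        "\<And>v. v \<in> cover a \<Longrightarrow> (l t E, v E) \<in> star_entourage a E E \<Longrightarrow> v \<in> U"
        using tc by (auto simp: eventually_cover_uniformity)
      have "\<forall>\<^sub>F s in at t within K. (l t E, l s E) \<in> star_entourage a E E"
        using near E(1) tK by simp
      then obtain T where T: "open T" "t \<in> T"
        "\<And>s. s \<in> T \<Longrightarrow> s \<noteq> t \<Longrightarrow> s \<in> K \<Longrightarrow> (l t E, l s E) \<in> star_entourage a E E"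
        by (auto simp: eventually_at_topological)
      have "l s \<in> U" if "s \<in> K \<inter> T" for s
        using that T(3)[of s] E(2)[of "l s"] into tU by (cases "s = t") auto
      then show ?thesis
        using T(1,2) tK by (intro exI[of _ "K \<inter> T"]) (auto intro: openin_open_Int)
    qed
    then have "openin (top_of_set K) {s \<in> K. l s \<in> U}"
      by (subst openin_subopen) blast
    then show "openin (top_of_set K) {s \<in> topspace (top_of_set K). l s \<in> U}"
      by simp
  qed
qed

text \<open>
  Closeness at level \<open>D\<close> makes the endpoints \<open>D\<close>-close, so it suffices to choose \<open>D\<close> so small that
  everything \<open>D\<close>-close to the given point lies in the given open set.
\<close>

lemma continuous_map_cover_proj:
  fixes a :: "'a::uniform_space"
  shows "continuous_map (cover_topology a) euclidean cover_proj"
  unfolding continuous_map_def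
proof (intro conjI allI impI)
  fix S :: "'a set" assume "openin euclidean S"
  then have S: "open S" by simp
  show "openin (cover_topology a) {u \<in> topspace (cover_topology a). cover_proj u \<in> S}"
    unfolding topspace_cover_topology unfolding cover_topology_def openin_uniform_topology
  proof (intro conjI ballI)
    fix u assume u: "u \<in> {u \<in> cover a. cover_proj u \<in> S}"
    let ?P = "\<lambda>(x, y). x = cover_proj u \<longrightarrow> y \<in> S"
    have ev: "eventually ?P uniformity"
      using S u by (auto simp: open_uniformity)
    define D where "D = {(x, y). ?P (x, y) \<and> ?P (y, x)}"
    have D: "entourage D"
      unfolding entourage_def D_def using eventually_conj[OF ev uniformity_sym[OF ev]]
      by (auto simp: sym_def case_prod_beta')
    have "cover_proj v \<in> S"
      if v: "v \<in> cover a" and star: "(u D, v D) \<in> star_entourage a D D" for v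
    proof -
      have "(endpoint (u D), endpoint (v D)) \<in> D"
        using star by (rule star_entourage_endpoint)
      then have "(cover_proj u, cover_proj v) \<in> D"
        using endpoint_cover[OF _ D, of u a] endpoint_cover[OF v D] u by simp
      then show ?thesis
        by (simp add: D_def)
    qed
    then show "eventually (\<lambda>(x', v). x' = u \<longrightarrow> v \<in> {u \<in> cover a. cover_proj u \<in> S})
        (cover_uniformity a)"
      unfolding eventually_cover_uniformity using D by auto
  qed auto
qed simp


section \<open>Lifting along the projection\<close>

definition is_lift ::
    "'a::uniform_space \<Rightarrow> 'b::topological_space set \<Rightarrow> ('b \<Rightarrow> 'a) \<Rightarrow>
     ('b \<Rightarrow> ('a \<times> 'a) set \<Rightarrow> 'a list set) \<Rightarrow> bool" where
  "is_lift a K f l \<longleftrightarrow>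
     continuous_map (top_of_set K) (cover_topology a) l \<and> (\<forall>t\<in>K. cover_proj (l t) = f t)"

lemma is_lift_cover: "is_lift a K f l \<Longrightarrow> t \<in> K \<Longrightarrow> l t \<in> cover a"
  by (auto simp: is_lift_def continuous_map_cover_iff)

lemma is_lift_star:
  "is_lift a K f l \<Longrightarrow> entourage E \<Longrightarrow> t \<in> K \<Longrightarrow>
    \<forall>\<^sub>F s in at t within K. (l t E, l s E) \<in> star_entourage a E E"
  by (auto simp: is_lift_def continuous_map_cover_iff)

lemma is_lift_endpoint:
  "is_lift a K f l \<Longrightarrow> entourage E \<Longrightarrow> t \<in> K \<Longrightarrow> endpoint (l t E) = f t"
  using is_lift_cover endpoint_cover by (metis is_lift_def)

lemma is_lift_compose:
  assumes "is_lift a K f l" "continuous_on J g" "g \<in> J \<rightarrow> K" "\<And>t. t \<in> J \<Longrightarrow> f' t = f (g t)"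
  shows "is_lift a J f' (\<lambda>t. l (g t))"
proof -
  have "continuous_map (top_of_set J) (top_of_set K) g"
    unfolding continuous_map_in_subtopology using assms(2,3) by auto
  then have "continuous_map (top_of_set J) (cover_topology a) (l \<circ> g)"
    by (rule continuous_map_compose) (use assms(1) in \<open>simp add: is_lift_def\<close>)
  moreover have "cover_proj (l (g t)) = f' t" if "t \<in> J" for t
    using assms(1,3,4) that by (auto simp: is_lift_def)
  ultimately show ?thesis
    by (simp add: is_lift_def o_def)
qed

lemma is_lift_const:
  assumes "u \<in> cover a" "\<And>t. t \<in> K \<Longrightarrow> f t = cover_proj u"
  shows "is_lift a K f (\<lambda>_. u)"
  using assms unfolding is_lift_def by simp

text \<open>
  Nearby values of a lift determine each other by \<open>star_entourage_unique\<close>. So agreement of \<open>L\<close> and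
  \<open>M\<close> spreads from each point to a neighbourhood, and so does disagreement.
\<close>

lemma star_lift_unique:
  assumes "connected K" "refl E" "sym E"
    and L: "\<And>t. t \<in> K \<Longrightarrow> \<forall>\<^sub>F s in at t within K. (L t, L s) \<in> star_entourage a E E"
    and M: "\<And>t. t \<in> K \<Longrightarrow> \<forall>\<^sub>F s in at t within K. (M t, M s) \<in> star_entourage a E E"
    and LM: "\<And>t. t \<in> K \<Longrightarrow> endpoint (L t) = endpoint (M t)"
    and s: "s \<in> K" "L s = M s" and t: "t \<in> K"
  shows "L t = M t"
proof (rule connected_induction_simple[OF \<open>connected K\<close>, where P = "\<lambda>t. L t = M t"])
  fix x assume x: "x \<in> K"
  have "\<forall>\<^sub>F y in at x within K.
      (L x, L y) \<in> star_entourage a E E \<and> (M x, M y) \<in> star_entourage a E E"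
    using L[OF x] M[OF x] by (rule eventually_conj)
  then obtain T where T: "open T" "x \<in> T" "\<And>y. y \<in> T \<Longrightarrow> y \<noteq> x \<Longrightarrow> y \<in> K \<Longrightarrow>
      (L x, L y) \<in> star_entourage a E E \<and> (M x, M y) \<in> star_entourage a E E"
    unfolding eventually_at_topological by blast
  have iff: "L x = M x \<longleftrightarrow> L y = M y" if y: "y \<in> K \<inter> T" for y
  proof (cases "y = x")
    case False
    then have star: "(L x, L y) \<in> star_entourage a E E" "(M x, M y) \<in> star_entourage a E E"
      using T(3) y by blast+
    note star' = star[THEN star_entourage_sym[OF \<open>sym E\<close>]]
    show ?thesis
      using star_entourage_unique[OF \<open>refl E\<close>, of "L x" "L y" a "M y"]
        star_entourage_unique[OF \<open>refl E\<close>, of "L y" "L x" a "M x"] star star' LM x y by auto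
  qed simp
  show "\<exists>T. openin (top_of_set K) T \<and> x \<in> T \<and> (\<forall>y\<in>T. \<forall>z\<in>T. L y = M y \<longrightarrow> L z = M z)"
    using iff T(1,2) x by (intro exI[of _ "K \<inter> T"]) (auto simp: openin_open)
qed (use s t in auto)

lemma lift_unique:
  fixes a :: "'a::uniform_space" and K :: "'b::topological_space set"
  assumes "connected K" "is_lift a K f l" "is_lift a K f m" "s \<in> K" "l s = m s" "t \<in> K"
  shows "l t = m t"
proof (rule cover_eqI)
  show "l t \<in> cover a" "m t \<in> cover a"
    using assms is_lift_cover by blast+
  fix E :: "('a \<times> 'a) set" assume E: "entourage E"
  show "l t E = m t E"
  proof (rule star_lift_unique[OF assms(1) entourage_refl[OF E] entourage_sym[OF E],
        where L = "\<lambda>t. l t E" and M = "\<lambda>t. m t E" and s = s])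
    fix x assume x: "x \<in> K"
    show "\<forall>\<^sub>F y in at x within K. (l x E, l y E) \<in> star_entourage a E E"
      using is_lift_star[OF assms(2) E x] .
    show "\<forall>\<^sub>F y in at x within K. (m x E, m y E) \<in> star_entourage a E E"
      using is_lift_star[OF assms(3) E x] .
    show "endpoint (l x E) = endpoint (m x E)"
      using is_lift_endpoint[OF assms(2) E x] is_lift_endpoint[OF assms(3) E x] by simp
  qed (use assms in auto)
qed

text \<open>
  Whether a lift takes the same value at \<open>s\<close> and \<open>t\<close> depends only on \<open>f\<close>. At each level \<open>E\<close>, some
  \<open>E\<close>-loop carries the value of \<open>l\<close> at \<open>s\<close> to that of \<open>m\<close>. Its action turns \<open>l\<close> into another
  lift, which agrees with \<open>m\<close> at \<open>s\<close> and therefore everywhere. The loops for different levels need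
  not be compatible.
\<close>

lemma lift_holonomy:
  fixes a :: "'a::uniform_space" and K :: "'b::topological_space set"
  assumes "connected K" "is_lift a K f l" "is_lift a K f m" "s \<in> K" "t \<in> K" "l s = l t"
  shows "m s = m t"
proof (rule cover_eqI)
  show "m s \<in> cover a" "m t \<in> cover a"
    using assms is_lift_cover by blast+
  fix E :: "('a \<times> 'a) set" assume E: "entourage E"
  note E' = entourage_refl[OF E] entourage_sym[OF E]
  obtain ws where ws: "chain E ws" "hd ws = a" "last ws = a" "prepend E ws (l s E) = m s E"
  proof (rule prepend_transitive[OF E'])
    show "l s E \<in> chain_space a E" "m s E \<in> chain_space a E"
      using assms E is_lift_cover cover_chain_space by blast+
    show "endpoint (l s E) = endpoint (m s E)"
      using assms E is_lift_endpoint by metis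
  qed
  have ends: "endpoint (prepend E ws (l x E)) = f x" if x: "x \<in> K" for x
  proof -
    obtain xs where xs: "l x E = chain_class E xs" "chain E xs" "hd xs = a"
      using cover_chain_space[OF is_lift_cover[OF assms(2) x] E] by (rule chain_spaceE)
    have "chain E (ws @ xs)"
      using xs ws E'(1) by (auto simp: chain_def successively_append_iff refl_on_def)
    then have "prepend E ws (l x E) = chain_class E (ws @ xs)"
      unfolding xs(1) using xs(2) by (rule prepend_chain_class)
    then show ?thesis
      using is_lift_endpoint[OF assms(2) E x] xs by (auto simp: chain_def)
  qed
  have "prepend E ws (l t E) = m t E"
  proof (rule star_lift_unique[OF assms(1) E', where L = "\<lambda>t. prepend E ws (l t E)"
        and M = "\<lambda>t. m t E" and s = s])
    fix x assume x: "x \<in> K"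
    show "\<forall>\<^sub>F y in at x within K.
        (prepend E ws (l x E), prepend E ws (l y E)) \<in> star_entourage a E E"
      using is_lift_star[OF assms(2) E x]
      by (rule eventually_mono) (use star_entourage_prepend[OF E'(1) ws(1,3)] ws(2) in auto)
    show "\<forall>\<^sub>F y in at x within K. (m x E, m y E) \<in> star_entourage a E E"
      using is_lift_star[OF assms(3) E x] .
    show "endpoint (prepend E ws (l x E)) = endpoint (m x E)"
      using ends[OF x] is_lift_endpoint[OF assms(3) E x] by simp
  qed (use assms ws in auto)
  then show "m s E = m t E"
    using ws(4) assms(6) by simp
qed

text \<open>
  This is the uniform continuity of continuous maps on compact sets, for maps into a uniform space: a
  Lebesgue number of a cover by balls on each of which \<open>f\<close> varies by less than half of \<open>E\<close>.
\<close>

lemma uniformly_close_on_compact: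
  fixes f :: "'b::metric_space \<Rightarrow> 'a::uniform_space"
  assumes "compact K" "continuous_on K f" "entourage E"
  obtains d where "d > 0" "\<And>s t. s \<in> K \<Longrightarrow> t \<in> K \<Longrightarrow> dist s t < d \<Longrightarrow> (f s, f t) \<in> E"
proof -
  obtain D where D: "entourage D" "D O D \<subseteq> E"
    using entourage_half[OF assms(3)] .
  have "\<exists>e>0. \<forall>y\<in>K. dist y x < e \<longrightarrow> (f x, f y) \<in> D" if x: "x \<in> K" for x
  proof -
    have "eventually (\<lambda>y. (f x, y) \<in> D) (nhds (f x))"
      using D(1) unfolding eventually_nhds_uniformity entourage_def
      by (auto elim!: eventually_mono)
    then have "\<forall>\<^sub>F y in at x within K. (f x, f y) \<in> D"
      using assms(2) x by (auto simp: continuous_on_def filterlim_iff)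
    then obtain e where "e > 0" "\<And>y. y \<in> K \<Longrightarrow> y \<noteq> x \<Longrightarrow> dist y x < e \<Longrightarrow> (f x, f y) \<in> D"
      unfolding eventually_at by blast
    moreover have "(f x, f x) \<in> D"
      using entourage_refl[OF D(1)] by (simp add: refl_on_def)
    ultimately show ?thesis by metis
  qed
  then obtain e where e: "\<And>x. x \<in> K \<Longrightarrow> e x > 0"
    "\<And>x y. x \<in> K \<Longrightarrow> y \<in> K \<Longrightarrow> dist y x < e x \<Longrightarrow> (f x, f y) \<in> D"
    by metis
  have "K \<subseteq> \<Union>((\<lambda>x. ball x (e x)) ` K)"
    using e(1) by auto
  then obtain d where d: "d > 0" "\<And>s. s \<in> K \<Longrightarrow> \<exists>G\<in>(\<lambda>x. ball x (e x)) ` K. ball s d \<subseteq> G"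
    using Heine_Borel_lemma[OF assms(1)] by (metis (no_types, lifting) imageE open_ball)
  show thesis
  proof (rule that[OF d(1)])
    fix s t assume st: "s \<in> K" "t \<in> K" "dist s t < d"
    obtain x where x: "x \<in> K" "ball s d \<subseteq> ball x (e x)"
      using d(2)[OF st(1)] by blast
    have "s \<in> ball s d" "t \<in> ball s d"
      using d(1) st(3) by auto
    then have "s \<in> ball x (e x)" "t \<in> ball x (e x)"
      using x(2) by blast+
    then have "(f x, f s) \<in> D" "(f x, f t) \<in> D"
      using e(2) x(1) st by (auto simp: dist_commute)
    then show "(f s, f t) \<in> E"
      using D entourage_sym[OF D(1)] by (blast dest: symD)
  qed
qed

lemma chain_class_stutter:
  assumes "refl E" "chain E xs"
  shows "chain_class E (xs @ map (\<lambda>_. last xs) [1..<Suc n]) = chain_class E xs"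
proof (induction n)
  case (Suc n)
  define ys where "ys = xs @ map (\<lambda>_. last xs) [1..<Suc n]"
  have ne: "xs \<noteq> []" using assms(2) by (simp add: chain_def)
  have last: "last ys = last xs" by (auto simp: ys_def last_append)
  have IH: "chain_class E ys = chain_class E xs"
    using Suc by (simp only: ys_def)
  then have "chain E ys"
    using chain_homotopic_ends(3)[of E ys xs] assms(2) by (simp add: chain_class_eq_iff)
  then have "chain_class E (ys @ [last xs]) = chain_class E ys"
    using chain_class_snoc_last[OF assms(1), of ys] last by simp
  then show ?case
    using IH by (simp add: ys_def)
qed simp

text \<open>
  The value of the lift at \<open>t\<close> extends the given chain by the images of \<open>n\<close> equally spaced points on
  the segment from \<open>p\<close> to \<open>t\<close>. For nearby \<open>s\<close> and \<open>t\<close> the two subdivided segments form a ladder,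
  so the values at \<open>s\<close> and \<open>t\<close> are one-point extensions of each other.
\<close>

lemma star_lift_exists:
  fixes K :: "'b::real_normed_vector set" and a :: "'a::uniform_space"
  assumes "compact K" "convex K" "p \<in> K" "continuous_on K f" "entourage E"
    and "C \<in> chain_space a E" "endpoint C = f p"
  obtains L where "L p = C" "\<And>t. t \<in> K \<Longrightarrow> L t \<in> chain_space a E"
    "\<And>t. t \<in> K \<Longrightarrow> endpoint (L t) = f t"
    "\<And>t. t \<in> K \<Longrightarrow> \<forall>\<^sub>F s in at t within K. (L t, L s) \<in> star_entourage a E E"
proof -
  note E = entourage_refl[OF assms(5)] entourage_sym[OF assms(5)]
  obtain xs where xs: "C = chain_class E xs" "chain E xs" "hd xs = a"
    using assms(6) by (rule chain_spaceE)
  have ne: "xs \<noteq> []" using xs(2) by (simp add: chain_def)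
  obtain d where d: "d > 0" "\<And>s t. s \<in> K \<Longrightarrow> t \<in> K \<Longrightarrow> dist s t < d \<Longrightarrow> (f s, f t) \<in> E"
    using uniformly_close_on_compact[OF assms(1,4,5)] by blast
  obtain r where r: "\<And>t. t \<in> K \<Longrightarrow> dist p t \<le> r"
    using compact_imp_bounded[OF assms(1)] by (auto simp: bounded_any_center[of _ p])
  obtain n :: nat where n: "2 * r / d < n"
    using reals_Archimedean2 by blast
  have "r \<ge> 0" using r[OF assms(3)] by simp
  then have n0: "n > 0"
    using n d(1) by (intro Nat.gr0I) (auto simp: field_simps)
  \<comment> \<open>With this \<open>n\<close> the steps of each subdivision are shorter than \<open>d / 2\<close>. Rungs between
    segments that end at distance less than \<open>d / 2\<close> are no longer than that, so the diagonals of
    the ladder are shorter than \<open>d\<close>.\<close>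
  define q where "q j t = p + (real j / real n) *\<^sub>R (t - p)" for j t
  have q_mem: "q j t \<in> K" if "j \<le> n" "t \<in> K" for j t
  proof -
    have "(1 - real j / real n) *\<^sub>R p + (real j / real n) *\<^sub>R t \<in> K"
      using assms(2,3) that n0 by (intro convexD) auto
    then show ?thesis by (simp add: q_def algebra_simps)
  qed
  have q_ends: "q 0 t = p" "q n t = t" for t
    using n0 by (simp_all add: q_def)
  have q_step: "dist (q j t) (q (Suc j) t) < d / 2" if "t \<in> K" for j t
  proof -
    have "q (Suc j) t - q j t = (1 / real n) *\<^sub>R (t - p)"
      by (simp add: q_def algebra_simps add_divide_distrib)
    then have "dist (q j t) (q (Suc j) t) = dist p t / real n"
      using n0 by (simp add: dist_norm norm_minus_commute[of "q j t"] norm_minus_commute[of p])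
    also have "\<dots> \<le> r / real n"
      using r[OF that] by (simp add: divide_right_mono)
    also have "\<dots> < d / 2"
      using n n0 d(1) by (simp add: field_simps)
    finally show ?thesis .
  qed
  have q_rung: "dist (q j s) (q j t) \<le> dist s t" if "j \<le> n" for j s t
  proof -
    have "q j s - q j t = (real j / real n) *\<^sub>R (s - t)"
      by (simp add: q_def algebra_simps)
    then have "dist (q j s) (q j t) = (real j / real n) * dist s t"
      by (simp add: dist_norm)
    also have "\<dots> \<le> 1 * dist s t"
      using that n0 by (intro mult_right_mono) auto
    finally show ?thesis by simp
  qed
  define L where "L t = chain_class E (xs @ map (\<lambda>j. f (q j t)) [1..<Suc n])" for t
  have start: "f (q 0 t) = last xs" for t
    using assms(7) xs(1) by (simp add: q_ends)
  have ladder: "chain E (xs @ map (\<lambda>j. f (q j t)) [1..<Suc n]) \<and>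
      last (xs @ map (\<lambda>j. f (q j t)) [1..<Suc n]) = f t \<and>
      L s = chain_class E ((xs @ map (\<lambda>j. f (q j t)) [1..<Suc n]) @ [f s])"
    if st: "s \<in> K" "t \<in> K" "dist s t < d / 2" for s t
  proof -
    have "(f (q j t), f (q j s)) \<in> E" if "j \<le> n" for j
      using q_rung[OF that, of t s] st d q_mem[OF that] by (simp add: dist_commute)
    moreover have "(f (q j t), f (q (Suc j) t)) \<in> E" "(f (q j s), f (q (Suc j) s)) \<in> E"
      if "j < n" for j
      using q_step[of t j] q_step[of s j] d st q_mem[of j] q_mem[of "Suc j"] that by simp_all
    moreover have "(f (q j s), f (q (Suc j) t)) \<in> E" if "j < n" for j
    proof -
      have "dist (q j s) (q (Suc j) t) \<le> dist (q j s) (q j t) + dist (q j t) (q (Suc j) t)"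
        by (rule dist_triangle)
      also have "\<dots> < d"
        using q_rung[of j s t] q_step[of t j] st that by simp
      finally show ?thesis
        using d(2) q_mem st that by simp
    qed
    ultimately show ?thesis
      using chain_class_ladder[OF E(1) xs(2), of "\<lambda>j. f (q j t)" "\<lambda>j. f (q j s)" n] start
      unfolding L_def by (simp add: q_ends del: upt_Suc)
  qed
  show thesis
  proof (rule that[of L])
    have "(\<lambda>j. f (q j p)) = (\<lambda>_. last xs)"
      using assms(7) xs(1) by (simp add: q_def)
    then show "L p = C"
      unfolding L_def xs(1) using chain_class_stutter[OF E(1) xs(2)] by simp
    fix t assume t: "t \<in> K"
    let ?ys = "xs @ map (\<lambda>j. f (q j t)) [1..<Suc n]"
    have ys: "chain E ?ys" "last ?ys = f t" "hd ?ys = a"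
      using ladder[OF t t] d(1) ne xs(3) by (simp_all del: upt_Suc)
    then show "L t \<in> chain_space a E" "endpoint (L t) = f t"
      unfolding L_def chain_space_def by (auto simp del: upt_Suc)
    have "(L t, L s) \<in> star_entourage a E E" if s: "s \<in> K" "dist s t < d / 2" for s
      unfolding L_def[of t] star_entourage_iff[OF E(1) subset_refl ys(1,3)]
      using ladder[OF s(1) t s(2)] d(2)[OF t s(1)] s d(1) by (auto simp: dist_commute simp del: upt_Suc)
    then show "\<forall>\<^sub>F s in at t within K. (L t, L s) \<in> star_entourage a E E"
      unfolding eventually_at using d(1) by (intro exI[of _ "d / 2"]) auto
  qed
qed

text \<open>
  The lifts to the levels \<open>X\<^sub>E\<close> are coherent, whatever subdivisions were used for them: the image
  in \<open>X\<^sub>E\<close> of the lift to a finer level \<open>X\<^sub>F\<close> is a lift with the same start, so it is the lift to \<open>X\<^sub>E\<close>.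
\<close>

lemma lift_exists:
  fixes K :: "'b::real_normed_vector set" and a :: "'a::uniform_space"
  assumes "compact K" "convex K" "p \<in> K" "continuous_on K f" "u \<in> cover a" "cover_proj u = f p"
  obtains l where "is_lift a K f l" "l p = u"
proof -
  let ?Q = "\<lambda>E L. L p = u E \<and> (\<forall>t\<in>K. L t \<in> chain_space a E \<and> endpoint (L t) = f t \<and>
      (\<forall>\<^sub>F s in at t within K. (L t, L s) \<in> star_entourage a E E))"
  have "\<exists>L. entourage E \<longrightarrow> ?Q E L" for E
  proof (cases "entourage E")
    case E: True
    have "endpoint (u E) = f p"
      using endpoint_cover[OF assms(5) E] assms(6) by simp
    then obtain L where "?Q E L"
      by (rule star_lift_exists[OF assms(1-4) E cover_chain_space[OF assms(5) E]]) blast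
    then show ?thesis by blast
  qed simp
  then have "\<forall>E. \<exists>L. entourage E \<longrightarrow> ?Q E L" by (rule allI)
  then obtain L where "\<forall>E. entourage E \<longrightarrow> ?Q E (L E)"
    by (rule choice[THEN exE])
  then have L: "\<And>E. entourage E \<Longrightarrow> L E p = u E"
    "\<And>E t. entourage E \<Longrightarrow> t \<in> K \<Longrightarrow> L E t \<in> chain_space a E"
    "\<And>E t. entourage E \<Longrightarrow> t \<in> K \<Longrightarrow> endpoint (L E t) = f t"
    "\<And>E t. entourage E \<Longrightarrow> t \<in> K \<Longrightarrow> \<forall>\<^sub>F s in at t within K. (L E t, L E s) \<in> star_entourage a E E"
    by simp_all
  have bond: "bond E (L F t) = L E t"
    if EF: "entourage E" "entourage F" "F \<subseteq> E" and t: "t \<in> K" for E F t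
  proof (rule star_lift_unique[OF convex_connected[OF assms(2)] entourage_refl[OF EF(1)]
        entourage_sym[OF EF(1)], where L = "\<lambda>t. bond E (L F t)" and M = "L E" and s = p])
    fix x assume x: "x \<in> K"
    show "\<forall>\<^sub>F s in at x within K. (bond E (L F x), bond E (L F s)) \<in> star_entourage a E E"
      using L(4)[OF EF(2) x]
      by (rule eventually_mono)
        (use star_entourage_bond[OF EF(3)] star_entourage_mono[OF EF(3)] in blast)
    show "\<forall>\<^sub>F s in at x within K. (L E x, L E s) \<in> star_entourage a E E"
      using L(4)[OF EF(1) x] .
    obtain xs where xs: "L F x = chain_class F xs"
      using L(2)[OF EF(2) x] by (rule chain_spaceE)
    show "endpoint (bond E (L F x)) = endpoint (L E x)"
      using L(3)[OF EF(2) x] L(3)[OF EF(1) x] by (simp add: xs bond_chain_class[OF EF(3)])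
  next
    show "bond E (L F p) = L E p"
      using L(1) EF cover_bond[OF assms(5)] by simp
  qed (use assms t in auto)
  define l where "l t = (\<lambda>E\<in>{E. entourage E}. L E t)" for t
  have l: "l t E = L E t" if "entourage E" for t E
    using that by (simp add: l_def)
  have cover: "l t \<in> cover a" if "t \<in> K" for t
    unfolding cover_def using L(2) bond that by (auto simp: l_def)
  show thesis
  proof (rule that[of l])
    have "continuous_map (top_of_set K) (cover_topology a) l"
      unfolding continuous_map_cover_iff using cover L(4) by (auto simp: l)
    moreover have "cover_proj (l t) = f t" if "t \<in> K" for t
      using endpoint_cover[OF cover[OF that] entourage_UNIV] L(3)[OF entourage_UNIV that]
      by (simp add: l entourage_UNIV)
    ultimately show "is_lift a K f l"
      by (simp add: is_lift_def)
    show "l p = u"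
      by (rule cover_eqI[OF cover[OF assms(3)] assms(5)]) (simp add: l L(1))
  qed
qed


section \<open>Paths and homotopies\<close>

lemma is_lift_path:
  assumes "is_lift a {0..1} c l"
  shows "path c"
proof -
  have "continuous_map (top_of_set {0..1}) euclidean (cover_proj \<circ> l)"
    using assms continuous_map_cover_proj unfolding is_lift_def by (blast intro: continuous_map_compose)
  then have "continuous_on {0..1} (\<lambda>t. cover_proj (l t))"
    by (simp add: o_def)
  then show ?thesis
    using assms unfolding path_def is_lift_def by (metis (no_types, lifting) continuous_on_cong)
qed

lemma cover_base_cover: "cover_base a \<in> cover a"
  unfolding cover_def cover_base_def chain_space_def
  by (auto simp: bond_chain_class chain_def intro!: exI[of _ "[a]"])

lemma cover_proj_base [simp]: "cover_proj (cover_base a) = a"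
  by (simp add: cover_proj_def cover_base_def entourage_UNIV last_chain_class)

text \<open>
  The definite description that defines the lift is meaningful: it is satisfied by the
  restriction of any lift to the unit interval, and by nothing else.
\<close>

lemma path_lift:
  assumes "path c" "c 0 = a"
  shows "is_lift a {0..1} c (path_lift a c)" and "path_lift a c 0 = cover_base a"
proof -
  let ?P = "\<lambda>l. l \<in> extensional {0..1} \<and> pathin (cover_topology a) l \<and>
     l 0 = cover_base a \<and> (\<forall>t\<in>{0..1}. cover_proj (l t) = c t)"
  obtain l where l: "is_lift a {0..1} c l" "l 0 = cover_base a"
    by (rule lift_exists[of "{0..1::real}" 0 c "cover_base a" a])
      (use assms cover_base_cover in \<open>auto simp: path_def\<close>)
  have "continuous_map (top_of_set {0..1}) (cover_topology a) (restrict l {0..1})"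
    by (rule continuous_map_eq[of _ _ l]) (use l(1) in \<open>auto simp: is_lift_def\<close>)
  then have ex: "?P (restrict l {0..1})"
    using l by (auto simp: is_lift_def pathin_def)
  have "m = restrict l {0..1}" if m: "?P m" for m
  proof (rule extensionalityI)
    have "is_lift a {0..1} c m"
      using m by (simp add: is_lift_def pathin_def)
    then show "m t = restrict l {0..1} t" if "t \<in> {0..1}" for t
      using lift_unique[of "{0..1}" a c m l 0 t] l m that by simp
  qed (use m in auto)
  with ex have "?P (path_lift a c)"
    unfolding path_lift_def by (rule theI[of ?P])
  then show "is_lift a {0..1} c (path_lift a c)" "path_lift a c 0 = cover_base a"
    by (simp_all add: is_lift_def pathin_def)
qed

text \<open>
  The homotopy is lifted over the square from the corner \<open>(0, 0)\<close>. Uniqueness identifies the lift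
  on each edge in turn: it is \<open>l\<close> and \<open>m\<close> on the two edges that carry the paths, and constant on
  the other two, where the homotopy is constant.
\<close>

lemma lift_path_homotopy:
  fixes a :: "'a::uniform_space"
  assumes "homotopic_paths UNIV c d"
    and l: "is_lift a {0..1} c l" and m: "is_lift a {0..1} d m" and lm: "l 0 = m 0"
  shows "l 1 = m 1"
    and "homotopic_with (\<lambda>r. r 0 = l 0 \<and> r 1 = l 1) (top_of_set {0..1}) (cover_topology a) l m"
proof -
  obtain h :: "real \<times> real \<Rightarrow> 'a" where "continuous_on ({0..1} \<times> {0..1}) h"
    "\<forall>t\<in>{0..1}. h (0, t) = c t" "\<forall>t\<in>{0..1}. h (1, t) = d t"
    "\<forall>s\<in>{0..1}. pathstart (h \<circ> Pair s) = pathstart c \<and> pathfinish (h \<circ> Pair s) = pathfinish c"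
    using assms(1) unfolding homotopic_paths by blast
  then have h: "continuous_on ({0..1} \<times> {0..1}) h"
    "\<And>t. t \<in> {0..1} \<Longrightarrow> h (0, t) = c t" "\<And>t. t \<in> {0..1} \<Longrightarrow> h (1, t) = d t"
    "\<And>s. s \<in> {0..1} \<Longrightarrow> h (s, 0) = c 0" "\<And>s. s \<in> {0..1} \<Longrightarrow> h (s, 1) = c 1"
    by (simp_all add: pathstart_def pathfinish_def)
  have l_cover: "l t \<in> cover a" "cover_proj (l t) = c t" if "t \<in> {0..1}" for t
    using is_lift_cover[OF l that] l that by (simp_all add: is_lift_def)
  obtain k where k: "is_lift a ({0..1} \<times> {0..1}) h k" "k (0, 0) = l 0"
    by (rule lift_exists[of "{0..1::real} \<times> {0..1::real}" "(0, 0)" h "l 0" a])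
      (use h l_cover[of 0] in \<open>auto intro: compact_Times convex_Times\<close>)
  have k_edge: "is_lift a {0..1} f (\<lambda>t. k (g t))"
    if "continuous_on {0..1} g" "g \<in> {0..1} \<rightarrow> {0..1} \<times> {0..1}" "\<And>t. t \<in> {0..1} \<Longrightarrow> f t = h (g t)"
    for f and g :: "real \<Rightarrow> real \<times> real"
    using is_lift_compose[OF k(1) that] .
  have bottom: "k (0, t) = l t" if "t \<in> {0..1}" for t
    by (rule lift_unique[of "{0..1}" a c "\<lambda>t. k (0, t)" l 0])
      (use h k l that in \<open>auto intro!: k_edge continuous_intros\<close>)
  have left: "k (s, 0) = l 0" if "s \<in> {0..1}" for s
    by (rule lift_unique[of "{0..1}" a "\<lambda>_. c 0" "\<lambda>s. k (s, 0)" "\<lambda>_. l 0" 0])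
      (use h k l_cover that in \<open>auto intro!: k_edge continuous_intros is_lift_const\<close>)
  have right: "k (s, 1) = l 1" if "s \<in> {0..1}" for s
    by (rule lift_unique[of "{0..1}" a "\<lambda>_. c 1" "\<lambda>s. k (s, 1)" "\<lambda>_. l 1" 0])
      (use h k l_cover bottom that in \<open>auto intro!: k_edge continuous_intros is_lift_const\<close>)
  have top: "k (1, t) = m t" if "t \<in> {0..1}" for t
    by (rule lift_unique[of "{0..1}" a d "\<lambda>t. k (1, t)" m 0])
      (use h m lm left that in \<open>auto intro!: k_edge continuous_intros\<close>)
  show "l 1 = m 1"
    using right[of 1] top[of 1] by simp
  have "continuous_map (prod_topology (top_of_set {0..1}) (top_of_set {0..1})) (cover_topology a) k"
    using k(1) by (simp add: is_lift_def flip: subtopology_Times)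
  moreover have "\<forall>s\<in>{0..1}. k (s, 0) = l 0 \<and> k (s, 1) = l 1"
    using left right by blast
  ultimately show "homotopic_with (\<lambda>r. r 0 = l 0 \<and> r 1 = l 1) (top_of_set {0..1})
      (cover_topology a) l m"
    using bottom top by (subst homotopic_with) (auto intro!: exI[of _ k])
qed

lemma natural_map_loop_class:
  fixes a :: "'a::uniform_space"
  assumes "path c" "c 0 = a"
  shows "natural_map a (loop_class c) = path_lift a c 1"
proof -
  have "path_lift a d 1 = path_lift a c 1" if d: "homotopic_paths UNIV c d" for d
  proof -
    have "path d" "d 0 = a"
      using d homotopic_paths_imp_path[OF d] homotopic_paths_imp_pathstart[OF d] assms(2)
      by (auto simp: pathstart_def)
    then show ?thesis
      using lift_path_homotopy(1)[OF d path_lift(1)[OF assms] path_lift(1)]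
        path_lift(2)[OF assms] path_lift(2)[of d a] by simp
  qed
  moreover have "homotopic_paths UNIV c c"
    using assms by simp
  ultimately have "(\<lambda>d. path_lift a d 1) ` loop_class c = {path_lift a c 1}"
    unfolding loop_class_def by blast
  then show ?thesis
    by (simp add: natural_map_def)
qed

text \<open>
  The groupoid laws with a constant path as the unit. They hold in every topological space;
  constant paths are written as functions because segments make sense only in vector spaces.
\<close>

lemma homotopic_paths_const_right:
  assumes "path p" "path_image p \<subseteq> S"
  shows "homotopic_paths S (p +++ (\<lambda>_. pathfinish p)) p"
proof (rule homotopic_paths_sym, rule homotopic_paths_reparametrize[OF assms])
  show "continuous_on {0..1} (\<lambda>t::real. min 1 (2 * t))"
    by (intro continuous_intros)
  show "(p +++ (\<lambda>_. pathfinish p)) t = p (min 1 (2 * t))" if "t \<in> {0..1}" for t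
    by (rule linorder_cases[of t "1 / 2"], simp_all only: joinpaths_def) (simp_all add: joinpaths_def pathfinish_def)
qed auto

lemma homotopic_paths_const_left:
  assumes "path p" "path_image p \<subseteq> S"
  shows "homotopic_paths S ((\<lambda>_. pathstart p) +++ p) p"
proof (rule homotopic_paths_sym, rule homotopic_paths_reparametrize[OF assms])
  show "continuous_on {0..1} (\<lambda>t::real. max 0 (2 * t - 1))"
    by (intro continuous_intros)
  show "((\<lambda>_. pathstart p) +++ p) t = p (max 0 (2 * t - 1))" if "t \<in> {0..1}" for t
    by (rule linorder_cases[of t "1 / 2"], simp_all only: joinpaths_def) (simp_all add: joinpaths_def pathstart_def)
qed auto

lemma homotopic_paths_reverse_left:
  assumes "path p" "path_image p \<subseteq> S"
  shows "homotopic_paths S (reversepath p +++ p) (\<lambda>_. pathfinish p)"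
  unfolding homotopic_paths
proof (intro exI conjI ballI)
  \<comment> \<open>At time \<open>s\<close> the path runs back only as far as \<open>p s\<close> before it returns to the end of \<open>p\<close>.\<close>
  let ?r = "\<lambda>(s, t). max s \<bar>2 * t - 1\<bar> :: real"
  let ?h = "\<lambda>z. p (?r z)"
  have r: "?r \<in> {0..1} \<times> {0..1} \<rightarrow> {0..1}"
    by auto
  have p: "continuous_on {0..1} p" using assms(1) by (simp add: path_def)
  have "continuous_on ({0..1} \<times> {0..1}) ?r"
    unfolding case_prod_beta' by (intro continuous_intros)
  then show "continuous_on ({0..1} \<times> {0..1}) ?h"
    by (rule continuous_on_compose2[OF p]) (use r in auto)
  show "?h \<in> {0..1} \<times> {0..1} \<rightarrow> S"
    using r assms(2) unfolding path_image_def by blast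
  fix x :: real assume x: "x \<in> {0..1}"
  show "?h (0, x) = (reversepath p +++ p) x"
    by (rule linorder_cases[of x "1 / 2"], simp_all only: joinpaths_def) (simp_all add: joinpaths_def reversepath_def)
  show "?h (1, x) = pathfinish p"
  proof -
    have "max 1 \<bar>2 * x - 1\<bar> = 1" using x by (auto simp: max_def)
    then show ?thesis by (simp add: pathfinish_def)
  qed
  show "pathstart (?h \<circ> Pair x) = pathstart (reversepath p +++ p)"
    "pathfinish (?h \<circ> Pair x) = pathfinish (reversepath p +++ p)"
    using x by (auto simp: pathstart_def pathfinish_def joinpaths_def reversepath_def max_def)
qed

text \<open>
  Multiply the null loop on the right by \<open>q\<close> and cancel the reverse of \<open>q\<close> against \<open>q\<close>.
\<close>

lemma homotopic_paths_if_loop_null: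
  assumes "homotopic_paths S (p +++ reversepath q) (\<lambda>_. pathstart p)"
    and "path p" "path q" "path_image p \<subseteq> S" "path_image q \<subseteq> S"
    and ends: "pathstart p = pathstart q" "pathfinish p = pathfinish q"
  shows "homotopic_paths S p q"
proof -
  have "homotopic_paths S p (p +++ (\<lambda>_. pathfinish q))"
    using homotopic_paths_const_right[OF assms(2,4)] ends by (simp add: homotopic_paths_sym_eq)
  also have "homotopic_paths S \<dots> (p +++ (reversepath q +++ q))"
    using homotopic_paths_reverse_left[OF assms(3,5)] assms
    by (intro homotopic_paths_join) (auto simp: homotopic_paths_sym_eq pathstart_def)
  also have "homotopic_paths S \<dots> ((p +++ reversepath q) +++ q)"
    using assms by (intro homotopic_paths_assoc) auto
  also have "homotopic_paths S \<dots> ((\<lambda>_. pathstart q) +++ q)"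
    using assms by (intro homotopic_paths_join) auto
  also have "homotopic_paths S \<dots> q"
    using assms by (intro homotopic_paths_const_left) auto
  finally show ?thesis .
qed

text \<open>
  Multiply on the left by the reverse of \<open>p\<close>.
\<close>

lemma homotopic_paths_join_cancel_left:
  assumes "homotopic_paths S (p +++ q) p"
    and "path p" "path q" "path_image p \<subseteq> S" "path_image q \<subseteq> S" "pathfinish p = pathstart q"
  shows "homotopic_paths S q (\<lambda>_. pathstart q)"
proof -
  have rev: "homotopic_paths S (reversepath p +++ p) (\<lambda>_. pathstart q)"
    using homotopic_paths_reverse_left[OF assms(2,4)] assms(6) by simp
  have "homotopic_paths S q ((\<lambda>_. pathstart q) +++ q)"
    using homotopic_paths_const_left[OF assms(3,5)] by (simp add: homotopic_paths_sym_eq)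
  also have "homotopic_paths S \<dots> ((reversepath p +++ p) +++ q)"
    using rev assms by (intro homotopic_paths_join) (auto simp: homotopic_paths_sym_eq pathfinish_def)
  also have "homotopic_paths S \<dots> (reversepath p +++ (p +++ q))"
    using assms by (subst homotopic_paths_sym_eq, intro homotopic_paths_assoc) auto
  also have "homotopic_paths S \<dots> (reversepath p +++ p)"
    using assms by (intro homotopic_paths_join) auto
  also have "homotopic_paths S \<dots> (\<lambda>_. pathstart q)"
    by (rule rev)
  finally show ?thesis .
qed

lemma loop_class_eq_iff:
  assumes "path c"
  shows "loop_class c = loop_class d \<longleftrightarrow> homotopic_paths UNIV c d"
proof
  assume "loop_class c = loop_class d"
  moreover have "c \<in> loop_class c" using assms by (simp add: loop_class_def)
  ultimately have "homotopic_paths UNIV d c" by (simp add: loop_class_def)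
  then show "homotopic_paths UNIV c d" by (rule homotopic_paths_sym)
next
  assume "homotopic_paths UNIV c d"
  then show "loop_class c = loop_class d"
    unfolding loop_class_def by (blast intro: homotopic_paths_trans homotopic_paths_sym)
qed


section \<open>Simple connectedness and injectivity\<close>

lemma inj_on_natural_map:
  fixes a :: "'a::uniform_space"
  assumes "simply_connected_space (cover_topology a)"
  shows "inj_on (natural_map a) (pi1 a)"
proof (rule inj_onI)
  fix C D assume "C \<in> pi1 a" "D \<in> pi1 a" and eq: "natural_map a C = natural_map a D"
  then obtain c d where c: "C = loop_class c" "path c" "c 0 = a" "c 1 = a"
    and d: "D = loop_class d" "path d" "d 0 = a" "d 1 = a"
    unfolding pi1_def pathstart_def pathfinish_def by blast
  let ?e = "c +++ reversepath d"
  have "path ?e"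
    by (rule path_join_imp) (use c d in \<open>simp_all add: pathfinish_def\<close>)
  moreover have "?e 0 = a"
    using c by (simp add: joinpaths_def)
  ultimately have e: "path ?e" "?e 0 = a" .
  define l where "l = path_lift a ?e"
  have l: "is_lift a {0..1} ?e l" "l 0 = cover_base a"
    unfolding l_def using path_lift[OF e] by auto
  \<comment> \<open>The first half of \<open>l\<close> is the lift of \<open>c\<close>. The second half, run backwards, lifts \<open>d\<close> and ends
    where the lift of \<open>d\<close> from the basepoint ends, so it is that lift and \<open>l\<close> is closed.\<close>
  have "is_lift a {0..1} c (\<lambda>t. l (t / 2))"
    by (rule is_lift_compose[OF l(1)]) (auto simp: joinpaths_def intro!: continuous_intros)
  then have "l (1 / 2) = path_lift a c 1"
    using lift_unique[of "{0..1}" a c "\<lambda>t. l (t / 2)" "path_lift a c" 0 1] path_lift[OF c(2,3)] l(2)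
    by simp
  also have "\<dots> = path_lift a d 1"
    using eq c d natural_map_loop_class by metis
  finally have half: "l (1 / 2) = path_lift a d 1" .
  have "is_lift a {0..1} d (\<lambda>t. l (1 - t / 2))"
    by (rule is_lift_compose[OF l(1)])
      (use c d in \<open>auto simp: joinpaths_def reversepath_def field_simps intro!: continuous_intros\<close>)
  then have l1: "l 1 = cover_base a"
    using lift_unique[of "{0..1}" a d "\<lambda>t. l (1 - t / 2)" "path_lift a d" 1 0] path_lift[OF d(2,3)] half
    by simp
  have "pathin (cover_topology a) l"
    using l(1) by (simp add: is_lift_def pathin_def)
  then have "homotopic_with (\<lambda>h. h 0 = cover_base a \<and> h 1 = cover_base a) (top_of_set {0..1})
      (cover_topology a) l (\<lambda>_. cover_base a)"
    using assms[unfolded simply_connected_space_def, rule_format, of l] l(2) l1 by simp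
  then have "homotopic_with (\<lambda>h. h 0 = a \<and> h 1 = a) (top_of_set {0..1}) euclidean
      (cover_proj \<circ> l) (cover_proj \<circ> (\<lambda>_. cover_base a))"
    by (rule homotopic_with_compose_continuous_map_left[OF _ continuous_map_cover_proj]) auto
  then have "homotopic_with (\<lambda>h. h 0 = a \<and> h 1 = a) (top_of_set {0..1}) euclidean ?e (\<lambda>_. a)"
    by (rule homotopic_with_eq) (use l(1) in \<open>auto simp: is_lift_def\<close>)
  then have "homotopic_paths UNIV ?e (\<lambda>_. pathstart c)"
    using e(2) c d by (simp add: homotopic_paths_def pathstart_def pathfinish_def joinpaths_def reversepath_def)
  then have "homotopic_paths UNIV c d"
    by (rule homotopic_paths_if_loop_null) (use c d in \<open>auto simp: pathstart_def pathfinish_def\<close>)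
  then show "C = D"
    using c d loop_class_eq_iff by metis
qed

lemma simply_connected_cover:
  fixes a :: "'a::uniform_space"
  assumes conn: "path_connected (UNIV :: 'a set)" and inj: "inj_on (natural_map a) (pi1 a)"
  shows "simply_connected_space (cover_topology a)"
  unfolding simply_connected_space_def
proof (intro allI impI)
  fix g assume g: "pathin (cover_topology a) g \<and> g 0 = g 1"
  define h where "h t = cover_proj (g t)" for t
  have gh: "is_lift a {0..1} h g"
    using g by (simp add: is_lift_def h_def pathin_def)
  have h: "path h" "h 1 = h 0"
    using is_lift_path[OF gh] g by (simp_all add: h_def)
  obtain p where p: "path p" "p 0 = a" "p 1 = h 0"
    using conn unfolding path_connected_def pathstart_def pathfinish_def by blast
  let ?c = "(p +++ h) +++ reversepath p"
  have ph: "path (p +++ h)" "pathfinish (p +++ h) = h 0"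
    using p h by (simp_all add: pathstart_def pathfinish_def path_join_imp) (simp add: joinpaths_def)
  have ph0: "(p +++ h) 0 = a"
    using p by (simp add: joinpaths_def)
  have "path ?c"
    by (rule path_join_imp) (use p ph in \<open>simp_all add: pathfinish_def\<close>)
  moreover have "?c 0 = a" "?c 1 = a"
    using p by (simp_all add: joinpaths_def reversepath_def)
  ultimately have c: "path ?c" "?c 0 = a" "?c 1 = a" .
  define l where "l = path_lift a ?c"
  have l: "is_lift a {0..1} ?c l" "l 0 = cover_base a"
    unfolding l_def using path_lift[OF c(1,2)] by auto
  \<comment> \<open>The path \<open>?c\<close> traverses \<open>p\<close> on \<open>[0, 1/4]\<close>, \<open>h\<close> on \<open>[1/4, 1/2]\<close> and \<open>p\<close> backwards on
    \<open>[1/2, 1]\<close>.\<close>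
  have outward: "is_lift a {0..1} p (\<lambda>t. l (t / 4))"
    by (rule is_lift_compose[OF l(1)]) (auto simp: joinpaths_def intro!: continuous_intros)
  have around: "is_lift a {0..1} h (\<lambda>t. l (1 / 4 + t / 4))"
    by (rule is_lift_compose[OF l(1)])
      (use p in \<open>auto simp: joinpaths_def field_simps intro!: continuous_intros\<close>)
  have inward: "is_lift a {0..1} p (\<lambda>t. l (1 - t / 2))"
    by (rule is_lift_compose[OF l(1)])
      (use p h in \<open>auto simp: joinpaths_def reversepath_def field_simps intro!: continuous_intros\<close>)
  \<comment> \<open>The lift of \<open>h\<close> inside \<open>l\<close> closes up because the lift \<open>g\<close> does.\<close>
  have "l (1 / 4) = l (1 / 2)"
    using lift_holonomy[OF _ gh around, of 0 1] g by simp
  then have "l 0 = l 1"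
    using lift_unique[OF _ outward inward, of 1 0] by simp
  then have "natural_map a (loop_class ?c) = cover_base a"
    using natural_map_loop_class[OF c(1,2)] l(2) by (simp add: l_def)
  moreover have "natural_map a (loop_class (\<lambda>_. a)) = cover_base a"
  proof -
    have const: "path (\<lambda>_::real. a)" by (simp add: path_def)
    have "is_lift a {0..1} (\<lambda>_::real. a) (\<lambda>_. cover_base a)"
      by (rule is_lift_const) (simp_all add: cover_base_cover)
    then show ?thesis
      using natural_map_loop_class[OF const] path_lift[OF const]
        lift_unique[of "{0..1}" a "\<lambda>_. a" "path_lift a (\<lambda>_. a)" "\<lambda>_. cover_base a" 0 1] by simp
  qed
  moreover have "loop_class ?c \<in> pi1 a" "loop_class (\<lambda>_. a) \<in> pi1 a"
    unfolding pi1_def using c by (auto simp: pathstart_def pathfinish_def path_def)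
  ultimately have "loop_class ?c = loop_class (\<lambda>_. a)"
    using inj by (metis inj_onD)
  then have null: "homotopic_paths UNIV ?c (\<lambda>_. a)"
    using loop_class_eq_iff[OF c(1)] by blast
  have "homotopic_paths UNIV (p +++ h) p"
    by (rule homotopic_paths_if_loop_null)
      (use null p h ph ph0 in \<open>simp_all add: pathstart_def pathfinish_def\<close>)
  then have hnull: "homotopic_paths UNIV h (\<lambda>_. pathstart h)"
    by (rule homotopic_paths_join_cancel_left) (use p h in \<open>auto simp: pathstart_def pathfinish_def\<close>)
  have const: "is_lift a {0..1} (\<lambda>_. pathstart h) (\<lambda>_. g 0)"
    using is_lift_cover[OF gh, of 0] by (intro is_lift_const) (auto simp: h_def pathstart_def)
  have "homotopic_with (\<lambda>r. r 0 = g 0 \<and> r 1 = g 1) (top_of_set {0..1})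
      (cover_topology a) g (\<lambda>_. g 0)"
    by (rule lift_path_homotopy(2)[OF hnull gh const refl])
  then show "homotopic_with (\<lambda>r. r 0 = g 0 \<and> r 1 = g 0) (top_of_set {0..1})
      (cover_topology a) g (\<lambda>_. g 0)"
    using g by simp
qed

theorem proposition78:
  fixes a :: "'a::uniform_space"
  assumes "coverable a"
  shows "(simply_connected_space (cover_topology a) \<longrightarrow> inj_on (natural_map a) (pi1 a)) \<and>
         (path_connected (UNIV :: 'a set) \<and> inj_on (natural_map a) (pi1 a) \<longrightarrow>
            simply_connected_space (cover_topology a))"
  using inj_on_natural_map simply_connected_cover by blast

end
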